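(* Let $\lambda_1,\lambda_2\in\mathbb{R}$ satisfy $0<|\lambda_1|<|\lambda_2|<1$, let $\Lambda:=\mathrm{diag}(\lambda_1,\lambda_2)$ and $\alpha_0:=1-\log|\lambda_2|/\log|\lambda_1|$. Then $\alpha_0$ is a sharp lower bound of the exponent $\alpha$ for $C^1$ linearization, in the following sense: for every $\alpha\in(0,\alpha_0]$ there exists a mapping $F:\mathbb{R}^2\to\mathbb{R}^2$ which is a $C^{1,\alpha}$ diffeomorphism in a neighborhood of the origin $O$ (onto its image), with $F(O)=O$ and $DF(O)=\Lambda$, such that $F$ cannot be $C^1$ linearized near $O$.
   Context: A mapping $F$ is $C^{1,\alpha}$ ($\alpha\in(0,1]$) if it is $C^1$ and $\sup_{x\ne y}\|DF(x)-DF(y)\|/\|x-y\|^{\alpha}<\infty$ on the region considered. $F$ (with $F(O)=O$, $DF(O)=\Lambda$) can be $C^1$ linearized near $O$ if there is a $C^1$ diffeomorphism $\Phi$ from a neighborhood of $O$ onto its image such that $\Phi\circ F=\Lambda\circ\Phi$ near $O$. The number $\alpha_0$ is called a lower bound for $C^1$ linearization because it was known previously that for $\alpha\in(\alpha_0,1]$ every $C^{1,\alpha}$ diffeomorphism $F$ with $F(O)=O$, $DF(O)=\Lambda$ can be $C^1$ linearized near $O$. *)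

theory Defs
  imports "HOL-Analysis.Analysis"
begin

text \<open>
  Derivatives are bounded linear maps of type \<open>'a \<Rightarrow>\<^sub>L 'b\<close>, so \<open>norm\<close> of a difference of
  derivatives is the operator norm. On an open set \<open>S\<close> the witness \<open>f'\<close> below is unique.
\<close>

definition C1_on :: "('a::real_normed_vector \<Rightarrow> 'b::real_normed_vector) \<Rightarrow> 'a set \<Rightarrow> bool" where
  "C1_on f S \<longleftrightarrow>
     (\<exists>f' :: 'a \<Rightarrow> 'a \<Rightarrow>\<^sub>L 'b.
        (\<forall>x\<in>S. (f has_derivative blinfun_apply (f' x)) (at x)) \<and>
        continuous_on S f')"

definition C1_holder_on ::
    "real \<Rightarrow> ('a::real_normed_vector \<Rightarrow> 'b::real_normed_vector) \<Rightarrow> 'a set \<Rightarrow> bool" where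
  "C1_holder_on \<alpha> f S \<longleftrightarrow>
     (\<exists>f' :: 'a \<Rightarrow> 'a \<Rightarrow>\<^sub>L 'b.
        (\<forall>x\<in>S. (f has_derivative blinfun_apply (f' x)) (at x)) \<and>
        continuous_on S f' \<and>
        (\<exists>K. \<forall>x\<in>S. \<forall>y\<in>S. x \<noteq> y \<longrightarrow> norm (f' x - f' y) / norm (x - y) powr \<alpha> \<le> K))"

definition C1_diffeo_on ::
    "('a::real_normed_vector \<Rightarrow> 'b::real_normed_vector) \<Rightarrow> 'a set \<Rightarrow> bool" where
  "C1_diffeo_on f U \<longleftrightarrow>
     open U \<and> open (f ` U) \<and> C1_on f U \<and>
     (\<exists>g. homeomorphism U (f ` U) f g \<and> C1_on g (f ` U))"

definition C1_holder_diffeo_on ::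
    "real \<Rightarrow> ('a::real_normed_vector \<Rightarrow> 'b::real_normed_vector) \<Rightarrow> 'a set \<Rightarrow> bool" where
  "C1_holder_diffeo_on \<alpha> f U \<longleftrightarrow>
     open U \<and> open (f ` U) \<and> C1_holder_on \<alpha> f U \<and>
     (\<exists>g. homeomorphism U (f ` U) f g \<and> C1_holder_on \<alpha> g (f ` U))"

text \<open>
  \<open>\<Phi>\<close> is a total function but only its values on \<open>U\<close> are meaningful; hence the
  condition \<open>F x \<in> U\<close>, which for \<open>F\<close> continuous at \<open>0\<close> with \<open>F 0 = 0\<close> only shrinks \<open>V\<close>.
\<close>

definition C1_linearizable_near_0 :: "real^'n^'n \<Rightarrow> (real^'n \<Rightarrow> real^'n) \<Rightarrow> bool" where
  "C1_linearizable_near_0 A F \<longleftrightarrow>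
     (\<exists>\<Phi> U V. 0 \<in> U \<and> C1_diffeo_on \<Phi> U \<and>
        open V \<and> 0 \<in> V \<and> V \<subseteq> U \<and>
        (\<forall>x\<in>V. F x \<in> U \<and> \<Phi> (F x) = A *v \<Phi> x))"

definition diag2 :: "real \<Rightarrow> real \<Rightarrow> real^2^2" where
  "diag2 a b = vector [vector [a, 0], vector [0, b]]"

definition alpha0 :: "real \<Rightarrow> real \<Rightarrow> real" where
  "alpha0 l1 l2 = 1 - ln \<bar>l2\<bar> / ln \<bar>l1\<bar>"

end

theory Submission
  imports Defs
begin

text \<open>
  Let \<open>\<sigma> = l1 / l2\<close>, so \<open>\<bar>\<sigma>\<bar> = \<bar>l1\<bar> powr alpha0 l1 l2\<close>. The map is
  \<open>F (x, y) = (l1 x + f (x, y), l2 y)\<close>, where \<open>f = (\<Sum>k. (l1 \<sigma>)^k P (\<cdot> / l1^k))\<close> superposes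
  rescaled copies of a compactly supported profile \<open>P\<close> that equals \<open>y\<close> for \<open>x\<close> near \<open>1\<close>, \<open>\<bar>y\<bar> \<le> \<bar>\<sigma>\<bar>\<close> and
  vanishes for \<open>\<bar>y\<bar> \<ge> 1\<close>. The copies have disjoint supports and the derivative of the \<open>k\<close>-th
  one has size \<open>\<bar>\<sigma>\<bar>^k\<close> at scale \<open>\<bar>l1\<bar>^k\<close>, whence the Hoelder exponent.

  Let \<open>\<phi>\<close> be the first coordinate of a \<open>C\<^sup>1\<close> linearization and \<open>y = \<sigma>^N\<close>. The orbit of
  \<open>(l1^m, l2^m y)\<close> gains the same relative drift \<open>y / l1\<close> at each of the steps
  \<open>n = m, \<dots>, N - 1\<close> and none afterwards. Comparing it with the orbit of \<open>(0, l2^m y)\<close> gives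
  \<open>\<phi> (l1^m, l2^m y) - \<phi> (0, l2^m y) = a l1^m (1 + (N - m) y / l1)\<close> with \<open>a \<noteq> 0\<close> the first
  partial derivative of \<open>\<phi>\<close> at \<open>0\<close>; for \<open>y = 0\<close> the same difference is \<open>a l1^m\<close>. The two
  values are \<open>O(y)\<close> apart because \<open>\<phi>\<close> is Lipschitz, so \<open>N - m\<close> stays bounded, a contradiction.
\<close>

subsection \<open>Bounded Lipschitz functions\<close>

text \<open>The regularity class for the derivative of the profile. Boundedness is demanded along
  with the Lipschitz estimate because it makes the class closed under products and yields a Hoelder
  estimate for every exponent in (0,1].\<close>

definition bounded_lipschitz :: "('a::real_normed_vector \<Rightarrow> 'b::real_normed_vector) \<Rightarrow> bool" where
  "bounded_lipschitz f \<longleftrightarrow>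
     (\<exists>C. (\<forall>x. norm (f x) \<le> C) \<and> (\<forall>x y. norm (f x - f y) \<le> C * norm (x - y)))"

lemma bounded_lipschitzI:
  assumes "\<And>x. norm (f x) \<le> C" "\<And>x y. norm (f x - f y) \<le> D * norm (x - y)"
  shows "bounded_lipschitz f"
  unfolding bounded_lipschitz_def
proof (intro exI[of _ "max C D"] conjI allI)
  show "norm (f x) \<le> max C D" for x
    using assms(1)[of x] by simp
  show "norm (f x - f y) \<le> max C D * norm (x - y)" for x y
    using assms(2)[of x y] mult_right_mono[of D "max C D" "norm (x - y)"] by simp
qed

lemma bounded_lipschitzE:
  assumes "bounded_lipschitz f"
  obtains C where "C \<ge> 0" "\<And>x. norm (f x) \<le> C" "\<And>x y. norm (f x - f y) \<le> C * norm (x - y)"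
  using assms unfolding bounded_lipschitz_def by (metis norm_ge_zero order_trans)

lemma bounded_lipschitz_add:
  assumes "bounded_lipschitz f" "bounded_lipschitz g"
  shows "bounded_lipschitz (\<lambda>x. f x + g x)"
proof -
  obtain C where C: "\<And>x. norm (f x) \<le> C" "\<And>x y. norm (f x - f y) \<le> C * norm (x - y)"
    using bounded_lipschitzE[OF assms(1)] by metis
  obtain D where D: "\<And>x. norm (g x) \<le> D" "\<And>x y. norm (g x - g y) \<le> D * norm (x - y)"
    using bounded_lipschitzE[OF assms(2)] by metis
  show ?thesis
  proof (rule bounded_lipschitzI)
    show "norm (f x + g x) \<le> C + D" for x
      by (intro norm_triangle_mono C D)
    show "norm (f x + g x - (f y + g y)) \<le> (C + D) * norm (x - y)" for x y
      unfolding add_diff_add distrib_right by (intro norm_triangle_mono C D)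
  qed
qed

lemma bounded_lipschitz_scaleR:
  fixes f :: "'a::real_normed_vector \<Rightarrow> real"
  assumes "bounded_lipschitz f" "bounded_lipschitz g"
  shows "bounded_lipschitz (\<lambda>x. f x *\<^sub>R g x)"
proof -
  obtain C where C: "C \<ge> 0" "\<And>x. norm (f x) \<le> C" "\<And>x y. norm (f x - f y) \<le> C * norm (x - y)"
    using bounded_lipschitzE[OF assms(1)] by metis
  obtain D where D: "D \<ge> 0" "\<And>x. norm (g x) \<le> D" "\<And>x y. norm (g x - g y) \<le> D * norm (x - y)"
    using bounded_lipschitzE[OF assms(2)] by metis
  show ?thesis
  proof (rule bounded_lipschitzI)
    show "norm (f x *\<^sub>R g x) \<le> C * D" for x
      unfolding norm_scaleR real_norm_def[symmetric] by (intro mult_mono C D) auto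
    fix x y
    have "f x *\<^sub>R g x - f y *\<^sub>R g y = (f x - f y) *\<^sub>R g x + f y *\<^sub>R (g x - g y)"
      by (simp add: algebra_simps)
    then have "norm (f x *\<^sub>R g x - f y *\<^sub>R g y) \<le> norm (f x - f y) * norm (g x) + norm (f y) * norm (g x - g y)"
      using norm_triangle_ineq[of "(f x - f y) *\<^sub>R g x" "f y *\<^sub>R (g x - g y)"] by simp
    also have "\<dots> \<le> (C * norm (x - y)) * D + C * (D * norm (x - y))"
      by (intro add_mono mult_mono C D mult_nonneg_nonneg norm_ge_zero)
    also have "\<dots> = (2 * C * D) * norm (x - y)"
      by simp
    finally show "norm (f x *\<^sub>R g x - f y *\<^sub>R g y) \<le> (2 * C * D) * norm (x - y)" .
  qed
qed

lemma bounded_lipschitz_mult: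
  fixes f g :: "'a::real_normed_vector \<Rightarrow> real"
  assumes "bounded_lipschitz f" "bounded_lipschitz g"
  shows "bounded_lipschitz (\<lambda>x. f x * g x)"
  using bounded_lipschitz_scaleR[OF assms] by simp

lemma bounded_lipschitz_const: "bounded_lipschitz (\<lambda>x. c)"
  by (rule bounded_lipschitzI[of _ "norm c" 0]) auto

lemma bounded_lipschitz_compose:
  assumes "bounded_lipschitz f" and "\<And>x y. norm (g x - g y) \<le> D * norm (x - y)"
  shows "bounded_lipschitz (\<lambda>x. f (g x))"
proof -
  obtain C where C: "C \<ge> 0" "\<And>x. norm (f x) \<le> C" "\<And>x y. norm (f x - f y) \<le> C * norm (x - y)"
    using bounded_lipschitzE[OF assms(1)] by metis
  show ?thesis
  proof (rule bounded_lipschitzI)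
    show "norm (f (g x)) \<le> C" for x by (rule C)
    show "norm (f (g x) - f (g y)) \<le> (C * D) * norm (x - y)" for x y
      using C(3)[of "g x" "g y"] mult_left_mono[OF assms(2)[of x y] C(1)] by simp
  qed
qed

lemma bounded_lipschitz_of_derivative:
  fixes f f' :: "real \<Rightarrow> real"
  assumes "\<And>t. (f has_real_derivative f' t) (at t)" "bounded_lipschitz f'" "\<And>t. \<bar>f t\<bar> \<le> B"
  shows "bounded_lipschitz f"
proof -
  obtain C where C: "\<And>x. norm (f' x) \<le> C"
    using bounded_lipschitzE[OF assms(2)] by metis
  show ?thesis
  proof (rule bounded_lipschitzI)
    show "norm (f x) \<le> B" for x using assms(3) by simp
    show "norm (f x - f y) \<le> C * norm (x - y)" for x y
      by (rule field_differentiable_bound[of UNIV f f' C]) (use assms(1) C in auto)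
  qed
qed

subsection \<open>A compactly supported profile\<close>

text \<open>Squared positive parts are the pieces of the quadratic splines below. At the kink the
  difference quotient is at most \<open>\<bar>y\<bar>\<close> in absolute value.\<close>

lemma has_real_derivative_pos_part_square:
  "((\<lambda>t::real. (max 0 t)\<^sup>2) has_real_derivative 2 * max 0 t) (at t)"
proof -
  consider "t < 0" | "t = 0" | "t > 0" by linarith
  then show ?thesis
  proof cases
    case 1
    have "((\<lambda>t::real. 0) has_real_derivative 0) (at t)" by simp
    then have "((\<lambda>t::real. (max 0 t)\<^sup>2) has_real_derivative 0) (at t)"
      by (rule has_field_derivative_transform_within_open[where S="{..<0}"]) (use 1 in auto)
    then show ?thesis using 1 by simp
  next
    case 2
    have "((\<lambda>y::real. ((max 0 y)\<^sup>2 - (max 0 0)\<^sup>2) / (y - 0)) \<longlongrightarrow> 0) (at 0)"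
    proof (rule Lim_null_comparison[where g="\<lambda>y. \<bar>y\<bar>"])
      show "\<forall>\<^sub>F y in at 0. norm (((max 0 y)\<^sup>2 - (max 0 0)\<^sup>2) / (y - 0)) \<le> \<bar>y::real\<bar>"
        by (intro always_eventually) (auto simp: max_def power2_eq_square)
      show "((\<lambda>y::real. \<bar>y\<bar>) \<longlongrightarrow> 0) (at 0)"
        by (intro tendsto_eq_intros) auto
    qed
    then show ?thesis using 2 by (simp add: has_field_derivative_iff)
  next
    case 3
    have "((\<lambda>t::real. t\<^sup>2) has_real_derivative 2 * t) (at t)"
      by (auto intro!: derivative_eq_intros)
    then have "((\<lambda>t::real. (max 0 t)\<^sup>2) has_real_derivative 2 * t) (at t)"
      by (rule has_field_derivative_transform_within_open[where S="{0<..}"]) (use 3 in auto)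
    then show ?thesis using 3 by simp
  qed
qed

text \<open>A quadratic spline with knots 0, 1/2, 1. Its second derivative is 4, then -4, then 0, so
  it climbs from 0 to 1 and has slope 0 at both ends.\<close>

definition ramp :: "real \<Rightarrow> real" where
  "ramp t = 2 * (max 0 t)\<^sup>2 - 4 * (max 0 (t - 1/2))\<^sup>2 + 2 * (max 0 (t - 1))\<^sup>2"

definition tent :: "real \<Rightarrow> real" where
  "tent t = 4 * max 0 (1/2 - \<bar>t - 1/2\<bar>)"

lemma ramp_le_0: "t \<le> 0 \<Longrightarrow> ramp t = 0"
  and ramp_ge_1: "t \<ge> 1 \<Longrightarrow> ramp t = 1"
  by (auto simp: ramp_def max_def power2_eq_square algebra_simps)

lemma abs_ramp_le: "\<bar>ramp t\<bar> \<le> 8"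
proof -
  consider "t \<le> 0" | "t \<ge> 1" | "0 < t" "t < 1" by linarith
  then show ?thesis
  proof cases
    case 3
    then have "(max 0 t)\<^sup>2 \<le> 1" "(max 0 (t - 1/2))\<^sup>2 \<le> 1" "(max 0 (t - 1))\<^sup>2 \<le> 1"
      by (auto intro!: power_le_one)
    moreover have "(max 0 t)\<^sup>2 \<ge> 0" "(max 0 (t - 1/2))\<^sup>2 \<ge> 0" "(max 0 (t - 1))\<^sup>2 \<ge> 0"
      by simp_all
    \<comment> \<open>Any uniform bound will do, so 8 = 2 + 4 + 2 is simply read off the
      coefficients.\<close>
    moreover have "\<bar>2 * a - 4 * b + 2 * c\<bar> \<le> 8"
      if "a \<le> 1" "b \<le> 1" "c \<le> 1" "a \<ge> 0" "b \<ge> 0" "c \<ge> 0" for a b c :: real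
      using that by linarith
    ultimately show ?thesis unfolding ramp_def by blast
  qed (simp_all add: ramp_le_0 ramp_ge_1)
qed

lemma has_real_derivative_ramp: "(ramp has_real_derivative tent t) (at t)"
proof -
  note D = has_real_derivative_pos_part_square
  have shift: "((\<lambda>t. (max 0 (t - c))\<^sup>2) has_real_derivative 2 * max 0 (t - c)) (at t)" for c :: real
    by (rule DERIV_chain2[where g="\<lambda>t. t - c" and Db=1, OF D, simplified]) (auto intro!: derivative_eq_intros)
  have "(ramp has_real_derivative
      2 * (2 * max 0 t) - 4 * (2 * max 0 (t - 1/2)) + 2 * (2 * max 0 (t - 1))) (at t)"
    unfolding ramp_def[abs_def] by (intro DERIV_add DERIV_diff DERIV_cmult D shift)
  moreover have "2 * (2 * max 0 t) - 4 * (2 * max 0 (t - 1/2)) + 2 * (2 * max 0 (t - 1)) = tent t"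
  proof -
    consider "t \<le> 0" | "0 < t" "t \<le> 1/2" | "1/2 < t" "t \<le> 1" | "t > 1" by linarith
    then show ?thesis
      by cases (simp_all add: tent_def)
  qed
  ultimately show ?thesis by simp
qed

lemma bounded_lipschitz_tent: "bounded_lipschitz tent"
proof (rule bounded_lipschitzI)
  fix x y :: real
  show "norm (tent x) \<le> 2"
    using abs_ge_zero[of "x - 1/2"] by (auto simp: tent_def max_def)
  have "norm (tent x - tent y) = 4 * \<bar>max 0 (1/2 - \<bar>x - 1/2\<bar>) - max 0 (1/2 - \<bar>y - 1/2\<bar>)\<bar>"
    by (simp add: tent_def right_diff_distrib[symmetric] abs_mult del: right_diff_distrib_numeral)
  also have "\<dots> \<le> 4 * \<bar>(1/2 - \<bar>x - 1/2\<bar>) - (1/2 - \<bar>y - 1/2\<bar>)\<bar>"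
    by (intro mult_left_mono) (auto simp: max_def)
  also have "\<dots> \<le> 4 * norm (x - y)"
    using abs_triangle_ineq3[of "y - 1/2" "x - 1/2"] by simp
  finally show "norm (tent x - tent y) \<le> 4 * norm (x - y)" .
qed

text \<open>A ramp rising over [-v, -w] minus one rising over [w, v], both stretched to the width
  \<open>e = v - w\<close>.\<close>

lemma obtain_C11_bump:
  fixes w v :: real
  assumes "0 \<le> w" "w < v"
  obtains b b' where "\<And>t. (b has_real_derivative b' t) (at t)"
    "bounded_lipschitz b" "bounded_lipschitz b'"
    "\<And>t. \<bar>t\<bar> \<le> w \<Longrightarrow> b t = 1" "\<And>t. \<bar>t\<bar> \<ge> v \<Longrightarrow> b t = 0" "\<And>t. \<bar>t\<bar> \<ge> v \<Longrightarrow> b' t = 0"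
proof -
  define e where "e = v - w"
  have e: "e > 0" using assms by (simp add: e_def)
  define b where "b t = ramp ((t + v) / e) - ramp ((t - w) / e)" for t
  define b' where "b' t = (1 / e) * tent ((t + v) / e) + (- 1 / e) * tent ((t - w) / e)" for t
  have D: "(b has_real_derivative b' t) (at t)" for t
    unfolding b_def[abs_def] b'_def
    using e by (auto intro!: derivative_eq_intros DERIV_chain2[OF has_real_derivative_ramp])
  have lin: "norm ((s + c) / e - (t + c) / e) \<le> (1 / e) * norm (s - t)" for s t c
    using e by (simp add: diff_divide_distrib[symmetric])
  have b': "bounded_lipschitz b'"
    unfolding b'_def[abs_def]
    using lin[of _ v] lin[of _ "-w"]
    by (intro bounded_lipschitz_add bounded_lipschitz_mult bounded_lipschitz_const
        bounded_lipschitz_compose[OF bounded_lipschitz_tent, where D="1/e"]) auto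
  have b: "bounded_lipschitz b"
  proof (rule bounded_lipschitz_of_derivative[OF D b'])
    show "\<bar>b t\<bar> \<le> 16" for t
      using abs_ramp_le[of "(t + v) / e"] abs_ramp_le[of "(t - w) / e"] by (simp add: b_def)
  qed
  have tent0: "tent t = 0" if "t \<le> 0 \<or> t \<ge> 1" for t
    using that by (auto simp: tent_def)
  show ?thesis
  proof
    fix t :: real
    show "b t = 1" if "\<bar>t\<bar> \<le> w"
    proof -
      have "(t + v) / e \<ge> 1" "(t - w) / e \<le> 0"
        using that e by (auto simp: e_def field_simps)
      then show ?thesis by (simp add: b_def ramp_ge_1 ramp_le_0)
    qed
    assume "\<bar>t\<bar> \<ge> v"
    then consider "t \<le> - v" | "t \<ge> v" by linarith
    then have "(t + v) / e \<le> 0 \<and> (t - w) / e \<le> 0 \<or> (t + v) / e \<ge> 1 \<and> (t - w) / e \<ge> 1"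
    proof cases
      case 1
      then show ?thesis using e assms by (simp add: divide_nonpos_pos)
    next
      case 2
      then show ?thesis using e assms by (simp add: le_divide_eq e_def)
    qed
    then show "b t = 0" "b' t = 0"
      by (auto simp: b_def b'_def ramp_ge_1 ramp_le_0 tent0)
  qed (use D b b' in auto)
qed

text \<open>The profile is a product a(x - 1) q(y) in the first coordinate, with q(y) = y b(y). The
  bump \<open>a\<close> has plateau radius \<open>d\<close> and support radius \<open>2 * d\<close>;
  the bump \<open>b\<close> has plateau radius \<open>\<rho>\<close> and support radius 1.\<close>

lemma obtain_planar_profile:
  fixes d \<rho> :: real
  assumes "d > 0" "0 \<le> \<rho>" "\<rho> < 1"
  obtains P :: "real^2 \<Rightarrow> real^2" and D where
    "\<And>z. (P has_derivative blinfun_apply (D z)) (at z)"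
    "bounded_lipschitz D"
    "\<And>z. P z $ 2 = 0"
    "\<And>z. \<bar>z$1 - 1\<bar> \<le> d \<Longrightarrow> \<bar>z$2\<bar> \<le> \<rho> \<Longrightarrow> P z $ 1 = z$2"
    "\<And>z. \<bar>z$1 - 1\<bar> \<ge> 2 * d \<Longrightarrow> P z = 0"
    "\<And>z. \<bar>z$1 - 1\<bar> \<ge> 2 * d \<Longrightarrow> D z = 0"
    "\<And>z. \<bar>z$2\<bar> \<ge> 1 \<Longrightarrow> P z = 0"
    "\<And>z. z$2 = 0 \<Longrightarrow> P z = 0"
proof -
  obtain a a' where a: "\<And>t. (a has_real_derivative a' t) (at t)"
    "bounded_lipschitz a" "bounded_lipschitz a'"
    "\<And>t. \<bar>t\<bar> \<le> d \<Longrightarrow> a t = 1" "\<And>t. \<bar>t\<bar> \<ge> 2 * d \<Longrightarrow> a t = 0" "\<And>t. \<bar>t\<bar> \<ge> 2 * d \<Longrightarrow> a' t = 0"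
    using obtain_C11_bump[of d "2 * d"] assms by auto
  obtain b b' where b: "\<And>t. (b has_real_derivative b' t) (at t)"
    "bounded_lipschitz b" "bounded_lipschitz b'"
    "\<And>t. \<bar>t\<bar> \<le> \<rho> \<Longrightarrow> b t = 1" "\<And>t. \<bar>t\<bar> \<ge> 1 \<Longrightarrow> b t = 0" "\<And>t. \<bar>t\<bar> \<ge> 1 \<Longrightarrow> b' t = 0"
    using obtain_C11_bump[of \<rho> 1] assms by auto
  \<comment> \<open>The identity is not bounded, so it is clamped to [-1, 1]. Since \<open>b\<close>
    and \<open>b'\<close> vanish where the clamp is active, the products with them do not
    change.\<close>
  define \<kappa> :: "real \<Rightarrow> real" where "\<kappa> t = max (-1) (min 1 t)" for t
  have \<kappa>: "bounded_lipschitz \<kappa>"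
    by (rule bounded_lipschitzI[of _ 1 1]) (auto simp: \<kappa>_def max_def min_def abs_if)
  define q where "q t = \<kappa> t * b t" for t
  define q' where "q' t = b t + \<kappa> t * b' t" for t
  have q_eq: "q t = t * b t" and q'_eq: "q' t = b t + t * b' t" for t
    using b(5,6)[of t] by (cases "\<bar>t\<bar> \<ge> 1"; auto simp: q_def q'_def \<kappa>_def)+
  have q: "bounded_lipschitz q" "bounded_lipschitz q'"
    unfolding q_def[abs_def] q'_def[abs_def]
    by (intro bounded_lipschitz_mult bounded_lipschitz_add \<kappa> b)+
  have Dq: "(q has_real_derivative q' t) (at t)" for t
    unfolding q_eq[abs_def] q'_eq by (auto intro!: derivative_eq_intros b(1))
  define e :: "real^2" where "e = axis 1 1"
  define E :: "2 \<Rightarrow> (real^2) \<Rightarrow>\<^sub>L (real^2)" where "E i = Blinfun (\<lambda>v. v$i *\<^sub>R e)" for i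
  have E: "blinfun_apply (E i) v = v$i *\<^sub>R e" for i v
    unfolding E_def by (subst bounded_linear_Blinfun_apply) (auto intro!: bounded_linear_intros)
  define P where "P z = (a (z$1 - 1) * q (z$2)) *\<^sub>R e" for z :: "real^2"
  define D where "D z = (a' (z$1 - 1) * q (z$2)) *\<^sub>R E 1 + (a (z$1 - 1) * q' (z$2)) *\<^sub>R E 2"
    for z :: "real^2"
  have proj: "norm ((x$i - c) - (y$i - c)) \<le> 1 * norm (x - y)" for x y :: "real^2" and i c
    using component_le_norm_cart[of "x - y" i] by simp
  have proj0: "norm (x$i - y$i) \<le> 1 * norm (x - y)" for x y :: "real^2" and i
    using proj[of x i 0 y] by simp
  show ?thesis
  proof
    fix z :: "real^2"
    have nth: "((\<lambda>z::real^2. z$i) has_derivative (\<lambda>v. v$i)) (at z)" for i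
      by (rule bounded_linear.has_derivative[OF bounded_linear_vec_nth has_derivative_ident])
    have 1: "((\<lambda>z::real^2. a (z$1 - 1)) has_derivative (\<lambda>v. v$1 * a' (z$1 - 1))) (at z)"
      by (rule DERIV_compose_FDERIV[OF a(1), of "\<lambda>z. z$1 - 1"]) (auto intro!: derivative_eq_intros nth)
    have 2: "((\<lambda>z::real^2. q (z$2)) has_derivative (\<lambda>v. v$2 * q' (z$2))) (at z)"
      by (rule DERIV_compose_FDERIV[OF Dq, of "\<lambda>z. z$2"]) (rule nth)
    show "(P has_derivative blinfun_apply (D z)) (at z)"
      unfolding P_def[abs_def]
      by (rule has_derivative_eq_rhs[OF has_derivative_scaleR_left[OF has_derivative_mult[OF 1 2]]])
        (auto simp: D_def E blinfun.bilinear_simps algebra_simps fun_eq_iff)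
    show "P z $ 2 = 0" by (simp add: P_def e_def axis_def)
    show "P z $ 1 = z$2" if "\<bar>z$1 - 1\<bar> \<le> d" "\<bar>z$2\<bar> \<le> \<rho>"
      using that by (simp add: P_def e_def axis_def q_eq a(4) b(4))
    show "P z = 0" "D z = 0" if "\<bar>z$1 - 1\<bar> \<ge> 2 * d"
      using that by (simp_all add: P_def D_def a(5,6))
    show "P z = 0" if "\<bar>z$2\<bar> \<ge> 1"
      using that by (simp add: P_def q_eq b(5))
    show "P z = 0" if "z$2 = 0"
      using that by (simp add: P_def q_eq)
  next
    show "bounded_lipschitz D"
      unfolding D_def[abs_def]
      by (intro bounded_lipschitz_add bounded_lipschitz_scaleR bounded_lipschitz_mult
          bounded_lipschitz_const bounded_lipschitz_compose[OF a(2), where D=1]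
          bounded_lipschitz_compose[OF a(3), where D=1] bounded_lipschitz_compose[OF q(1), where D=1]
          bounded_lipschitz_compose[OF q(2), where D=1] proj proj0)
  qed
qed

subsection \<open>Self-similar sums\<close>

lemma power_powr_commute:
  fixes r :: real
  assumes "r > 0"
  shows "(r powr a) ^ k = (r ^ k) powr a"
  using assms by (simp add: powr_realpow[symmetric] powr_powr mult.commute)

lemma continuous_on_of_holder:
  fixes f :: "'a::real_normed_vector \<Rightarrow> 'b::real_normed_vector"
  assumes "\<alpha> > 0" "\<And>x y. x \<in> S \<Longrightarrow> y \<in> S \<Longrightarrow> norm (f x - f y) \<le> K * norm (x - y) powr \<alpha>"
  shows "continuous_on S f"
  unfolding continuous_on_def
proof
  fix x assume x: "x \<in> S"
  have "((\<lambda>y. norm (y - x)) \<longlongrightarrow> 0) (at x within S)"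
    by (intro tendsto_eq_intros) auto
  then have "((\<lambda>y. norm (y - x) powr \<alpha>) \<longlongrightarrow> 0 powr \<alpha>) (at x within S)"
    using assms(1) by (intro tendsto_powr') auto
  then have lim: "((\<lambda>y. K * norm (y - x) powr \<alpha>) \<longlongrightarrow> 0) (at x within S)"
    using assms(1) by (auto intro!: tendsto_mult_right_zero)
  have "((\<lambda>y. f y - f x) \<longlongrightarrow> 0) (at x within S)"
  proof (rule Lim_null_comparison[OF _ lim])
    show "\<forall>\<^sub>F y in at x within S. norm (f y - f x) \<le> K * norm (y - x) powr \<alpha>"
      using assms(2) x by (auto simp: eventually_at intro!: exI[of _ 1])
  qed
  then show "(f \<longlongrightarrow> f x) (at x within S)"
    by (rule LIM_zero_cancel)
qed

text \<open>The product form of the estimate also covers x = y and already implies continuity of the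
  derivative.\<close>

lemma C1_holder_onI:
  assumes "\<alpha> > 0"
    and "\<And>x. x \<in> S \<Longrightarrow> (f has_derivative blinfun_apply (f' x)) (at x)"
    and "\<And>x y. x \<in> S \<Longrightarrow> y \<in> S \<Longrightarrow> norm (f' x - f' y) \<le> K * norm (x - y) powr \<alpha>"
  shows "C1_holder_on \<alpha> f S"
  unfolding C1_holder_on_def
proof (intro exI conjI ballI impI)
  show "continuous_on S f'"
    using assms(1,3) by (rule continuous_on_of_holder)
  show "norm (f' x - f' y) / norm (x - y) powr \<alpha> \<le> K" if "x \<in> S" "y \<in> S" "x \<noteq> y" for x y
    using assms(3)[of x y] that by (simp add: divide_le_eq)
qed (rule assms(2))

text \<open>The sum of the derivatives converges uniformly because \<bar>\<sigma>\<bar> < 1. At the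
  endpoint \<open>\<bar>\<sigma>\<bar> = \<bar>l\<bar> powr \<alpha>\<close> the Hoelder estimates
  of the summands do not decay in k, so they cannot be added up; \<open>disj\<close> ensures that at
  most two of them enter any difference.\<close>

lemma self_similar_sum_C1_holder:
  fixes P :: "'a::real_normed_vector \<Rightarrow> 'b::banach" and D :: "'a \<Rightarrow> 'a \<Rightarrow>\<^sub>L 'b"
  assumes der: "\<And>z. (P has_derivative blinfun_apply (D z)) (at z)"
    and D: "bounded_lipschitz D" and P0: "P 0 = 0"
    and \<alpha>: "0 < \<alpha>" "\<alpha> \<le> 1" and l: "l \<noteq> 0" and \<sigma>: "\<bar>\<sigma>\<bar> < 1" "\<bar>\<sigma>\<bar> \<le> \<bar>l\<bar> powr \<alpha>"
    and disj: "\<And>z j k. D (inverse (l^j) *\<^sub>R z) \<noteq> 0 \<Longrightarrow> D (inverse (l^k) *\<^sub>R z) \<noteq> 0 \<Longrightarrow> j = k"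
  obtains f f' K where
    "\<forall>z. (\<lambda>k. (l * \<sigma>)^k *\<^sub>R P (inverse (l^k) *\<^sub>R z)) sums f z"
    "\<forall>z. (f has_derivative blinfun_apply (f' z)) (at z)"
    "\<forall>z w. norm (f' z - f' w) \<le> K * norm (z - w) powr \<alpha>"
    "f' 0 = (\<Sum>k. \<sigma>^k *\<^sub>R D 0)"
proof -
  obtain C where C: "C \<ge> 0" "\<And>x. norm (D x) \<le> C" "\<And>x y. norm (D x - D y) \<le> C * norm (x - y)"
    using bounded_lipschitzE[OF D] by metis
  \<comment> \<open>The derivative of the k-th summand: the inner scaling contributes
    \<open>inverse (l^k)\<close>, which cancels the factor \<open>l^k\<close> in front.\<close>
  define T where "T k z = \<sigma>^k *\<^sub>R D (inverse (l^k) *\<^sub>R z)" for k z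
  have T: "norm (T k z) \<le> C * \<bar>\<sigma>\<bar>^k" for k z
    unfolding T_def using mult_right_mono[OF C(2)[of "inverse (l^k) *\<^sub>R z"], of "\<bar>\<sigma>\<bar>^k"]
    by (simp add: power_abs mult.commute)
  have geo: "summable (\<lambda>k. C * \<bar>\<sigma>\<bar>^k)"
    using \<sigma> by (intro summable_mult summable_geometric) auto
  have sT: "summable (\<lambda>k. T k z)" for z
    by (rule summable_comparison_test'[OF geo, of 0]) (rule T)
  define f' where "f' z = (\<Sum>k. T k z)" for z
  have "uniform_limit UNIV (\<lambda>n z. \<Sum>k<n. T k z) f' sequentially"
    unfolding f'_def by (rule Weierstrass_m_test[OF T geo])
  then have unif: "\<forall>\<^sub>F n in sequentially. \<forall>z. norm ((\<Sum>k<n. T k z) - f' z) < e" if "e > 0" for e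
    using that by (auto simp: uniform_limit_iff dist_norm)
  have "\<exists>f. \<forall>z\<in>UNIV. (\<lambda>k. (l * \<sigma>)^k *\<^sub>R P (inverse (l^k) *\<^sub>R z)) sums f z \<and>
      (f has_derivative blinfun_apply (f' z)) (at z within UNIV)"
  proof (rule has_derivative_series[where f'="\<lambda>k z. blinfun_apply (T k z)"])
    fix k z
    have "((\<lambda>z. P (inverse (l^k) *\<^sub>R z)) has_derivative
        (\<lambda>v. D (inverse (l^k) *\<^sub>R z) (inverse (l^k) *\<^sub>R v))) (at z)"
      by (rule has_derivative_compose[OF has_derivative_scaleR_right[OF has_derivative_ident] der])
    then have "((\<lambda>z. (l * \<sigma>)^k *\<^sub>R P (inverse (l^k) *\<^sub>R z)) has_derivative
        (\<lambda>v. (l * \<sigma>)^k *\<^sub>R D (inverse (l^k) *\<^sub>R z) (inverse (l^k) *\<^sub>R v))) (at z)"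
      by (rule has_derivative_scaleR_right)
    then show "((\<lambda>z. (l * \<sigma>)^k *\<^sub>R P (inverse (l^k) *\<^sub>R z)) has_derivative blinfun_apply (T k z))
        (at z within UNIV)"
      by (rule has_derivative_eq_rhs[OF has_derivative_at_withinI])
        (use l in \<open>simp add: T_def blinfun.bilinear_simps power_mult_distrib fun_eq_iff\<close>)
  next
    fix e :: real assume "e > 0"
    from unif[OF this]
    show "\<forall>\<^sub>F n in sequentially. \<forall>z\<in>UNIV. \<forall>h.
        norm ((\<Sum>i<n. blinfun_apply (T i z) h) - blinfun_apply (f' z) h) \<le> e * norm h"
    proof eventually_elim
      case (elim n)
      show ?case
      proof (intro ballI allI)
        fix z h
        have "norm (((\<Sum>i<n. T i z) - f' z) h) \<le> norm ((\<Sum>i<n. T i z) - f' z) * norm h"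
          by (rule norm_blinfun)
        also have "\<dots> \<le> e * norm h"
          using elim by (intro mult_right_mono) (auto intro: less_imp_le)
        finally show "norm ((\<Sum>i<n. blinfun_apply (T i z) h) - blinfun_apply (f' z) h) \<le> e * norm h"
          by (simp add: blinfun.bilinear_simps blinfun.sum_left)
      qed
    qed
  next
    \<comment> \<open>Differentiating a series termwise needs convergence at one point; at 0 every
      term vanishes.\<close>
    show "(\<lambda>k. (l * \<sigma>)^k *\<^sub>R P (inverse (l^k) *\<^sub>R 0)) sums 0"
      by (simp add: P0)
  qed auto
  then obtain f where f: "\<And>z. (\<lambda>k. (l * \<sigma>)^k *\<^sub>R P (inverse (l^k) *\<^sub>R z)) sums f z"
    "\<And>z. (f has_derivative blinfun_apply (f' z)) (at z)"
    by auto
  \<comment> \<open>Interpolation: in the rescaled distance \<open>u\<close>, the Lipschitz bound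
    \<open>C * u\<close> serves for u \<le> 1 and the bound \<open>2 * C\<close> for u > 1, and both
    are at most \<open>2 * C * u powr \<alpha>\<close>. The factor
    \<open>\<bar>\<sigma>\<bar>^k\<close> then absorbs the rescaling, so the constant is independent
    of k.\<close>
  have term_bound: "norm (T k z - T k w) \<le> 2 * C * norm (z - w) powr \<alpha>" for k z w
  proof (cases "z = w")
    case False
    define t where "t = norm (z - w)"
    define u where "u = t / \<bar>l\<bar>^k"
    have t: "t > 0" and u: "u > 0" using False l by (auto simp: t_def u_def)
    let ?d = "norm (D (inverse (l^k) *\<^sub>R z) - D (inverse (l^k) *\<^sub>R w))"
    have "?d \<le> C * norm (inverse (l^k) *\<^sub>R z - inverse (l^k) *\<^sub>R w)"
      by (rule C)
    also have "norm (inverse (l^k) *\<^sub>R z - inverse (l^k) *\<^sub>R w) = u"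
      by (simp add: scaleR_diff_right[symmetric] u_def t_def power_abs divide_inverse mult.commute)
    finally have 1: "?d \<le> C * u" .
    have 2: "?d \<le> 2 * C"
      using norm_triangle_ineq4[of "D (inverse (l^k) *\<^sub>R z)" "D (inverse (l^k) *\<^sub>R w)"] C(2)
      by (smt (verit))
    have "?d \<le> 2 * C * u powr \<alpha>"
    proof (cases "u \<le> 1")
      case True
      then have "u powr 1 \<le> u powr \<alpha>" using \<alpha> u by (intro powr_mono') auto
      then have "C * u \<le> C * u powr \<alpha>" using u C(1) by (intro mult_left_mono) auto
      moreover have "C * u powr \<alpha> \<ge> 0" using C(1) by simp
      ultimately show ?thesis using 1 by linarith
    next
      case False
      then have "1 \<le> u powr \<alpha>" using \<alpha> by (intro ge_one_powr_ge_zero) auto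
      then have "2 * C * 1 \<le> 2 * C * u powr \<alpha>" using C(1) by (intro mult_left_mono) auto
      then show ?thesis using 2 by linarith
    qed
    moreover have "\<bar>\<sigma>\<bar>^k * u powr \<alpha> \<le> t powr \<alpha>"
    proof -
      have "\<bar>\<sigma>\<bar>^k \<le> (\<bar>l\<bar> powr \<alpha>)^k" using \<sigma> by (intro power_mono) auto
      also have "\<dots> = (\<bar>l\<bar>^k) powr \<alpha>" using l by (simp add: power_powr_commute)
      finally have "\<bar>\<sigma>\<bar>^k * u powr \<alpha> \<le> (\<bar>l\<bar>^k) powr \<alpha> * u powr \<alpha>"
        by (intro mult_right_mono) auto
      also have "\<dots> = t powr \<alpha>"
        using l t u by (simp add: powr_mult[symmetric] u_def)
      finally show ?thesis .
    qed
    ultimately have "\<bar>\<sigma>\<bar>^k * ?d \<le> 2 * C * t powr \<alpha>"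
      using mult_left_mono[of ?d "2 * C * u powr \<alpha>" "\<bar>\<sigma>\<bar>^k"]
        mult_left_mono[of "\<bar>\<sigma>\<bar>^k * u powr \<alpha>" "t powr \<alpha>" "2 * C"] C(1)
      by (simp add: mult_ac)
    then show ?thesis
      by (simp add: T_def scaleR_diff_right[symmetric] power_abs t_def)
  qed simp
  have holder: "norm (f' z - f' w) \<le> (4 * C) * norm (z - w) powr \<alpha>" for z w
  proof -
    \<comment> \<open>Each of the two points sees at most one nonzero term, so only the indices
      \<open>j1\<close> and \<open>j2\<close>, possibly equal, survive in the difference of the
      sums.\<close>
    have "\<exists>j. \<forall>k. k \<noteq> j \<longrightarrow> T k z = 0" for z
      using disj[of _ z] unfolding T_def by (metis scaleR_zero_right)
    then obtain j1 j2 where j: "\<And>k. k \<noteq> j1 \<Longrightarrow> T k z = 0" "\<And>k. k \<noteq> j2 \<Longrightarrow> T k w = 0"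
      by meson
    have "f' z - f' w = (\<Sum>k. T k z - T k w)"
      unfolding f'_def by (rule suminf_diff[OF sT sT])
    also have "\<dots> = (\<Sum>k\<in>{j1,j2}. T k z - T k w)"
      by (rule suminf_finite) (auto simp: j)
    finally have "norm (f' z - f' w) \<le> (\<Sum>k\<in>{j1,j2}. norm (T k z - T k w))"
      by (simp add: norm_sum del: sum.insert_if)
    also have "\<dots> \<le> of_nat (card {j1,j2}) * (2 * C * norm (z - w) powr \<alpha>)"
      by (intro sum_bounded_above term_bound)
    also have "\<dots> \<le> of_nat 2 * (2 * C * norm (z - w) powr \<alpha>)"
      using C(1) by (intro mult_right_mono) (auto simp: card_insert_if)
    finally show ?thesis by simp
  qed
  show ?thesis
    by (rule that[of f f' "4 * C"]) (use f holder in \<open>auto simp: f'_def T_def\<close>)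
qed

subsection \<open>Local Hoelder diffeomorphisms\<close>

text \<open>The inverse function theorem supplies a differentiable local inverse. On a small ball in
  the image its derivative is uniformly bounded and inherits the Hoelder exponent.\<close>

lemma C1_holder_diffeo_near_invertible_derivative:
  fixes F :: "'a::euclidean_space \<Rightarrow> 'a"
  assumes \<alpha>: "0 < \<alpha>"
    and der: "\<And>x. (F has_derivative blinfun_apply (F' x)) (at x)"
    and holder: "\<And>x y. norm (F' x - F' y) \<le> K * norm (x - y) powr \<alpha>"
    and inv: "I o\<^sub>L F' x0 = id_blinfun"
  shows "\<exists>U. x0 \<in> U \<and> C1_holder_diffeo_on \<alpha> F U"
proof -
  have contF': "continuous_on UNIV F'"
    using \<alpha> holder by (rule continuous_on_of_holder)
  obtain U V g g' where U: "open U" "x0 \<in> U" and V: "open V" "F x0 \<in> V"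
    and hom: "homeomorphism U V F g"
    and g: "\<And>y. y \<in> V \<Longrightarrow> (g has_derivative g' y) (at y)"
    and g': "\<And>y. y \<in> V \<Longrightarrow> g' y = Hilbert_Choice.inv (blinfun_apply (F' (g y)))"
    and bij: "\<And>y. y \<in> V \<Longrightarrow> bij (blinfun_apply (F' (g y)))"
    using inverse_function_theorem[OF open_UNIV der contF' UNIV_I inv] by metis
  define B where "B = norm I + 1"
  have B: "B > 0" by (simp add: B_def add_nonneg_pos)
  have lower0: "norm v \<le> B * norm (F' x0 v)" for v
  proof -
    have "v = I (F' x0 v)"
      using arg_cong[OF inv, of "\<lambda>f. blinfun_apply f v"] by simp
    then have "norm v \<le> norm I * norm (F' x0 v)" by (metis norm_blinfun)
    also have "\<dots> \<le> B * norm (F' x0 v)" by (intro mult_right_mono) (auto simp: B_def)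
    finally show ?thesis .
  qed
  have "isCont F' x0"
    using contF' by (simp add: continuous_on_eq_continuous_at)
  then obtain r where r: "r > 0" "\<And>x. dist x x0 < r \<Longrightarrow> norm (F' x - F' x0) < 1 / (2 * B)"
    using B unfolding continuous_at_eps_delta dist_norm by (metis zero_less_divide_1_iff mult_pos_pos zero_less_numeral)
  \<comment> \<open>A perturbation of \<open>F' x0\<close> of size below 1 / (2 B) costs at most
    half of its lower bound, so the lower bound is uniform near \<open>x0\<close>.\<close>
  have lower: "norm v \<le> 2 * B * norm (F' x v)" if "dist x x0 < r" for x v
  proof -
    have "norm ((F' x - F' x0) v) \<le> 1 / (2 * B) * norm v"
      using norm_blinfun[of "F' x - F' x0" v] mult_right_mono[OF less_imp_le[OF r(2)[OF that]], of "norm v"]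
      by simp
    moreover have "norm (F' x0 v) \<le> norm (F' x v) + norm ((F' x - F' x0) v)"
      using norm_triangle_ineq4[of "F' x v" "(F' x - F' x0) v"] by (simp add: blinfun.bilinear_simps)
    ultimately have "B * norm (F' x0 v) \<le> B * (norm (F' x v) + 1 / (2 * B) * norm v)"
      using B by (intro mult_left_mono) auto
    then show ?thesis
      using lower0[of v] B by (simp add: algebra_simps)
  qed
  have gx0: "g (F x0) = x0" using hom U by (simp add: homeomorphism_def)
  have contg: "continuous_on V g" using hom by (simp add: homeomorphism_def)
  then have "isCont g (F x0)"
    using V by (simp add: continuous_on_eq_continuous_at)
  then obtain e1 where e1: "e1 > 0" "\<And>y. dist y (F x0) < e1 \<Longrightarrow> dist (g y) x0 < r"
    using r(1) gx0 unfolding continuous_at_eps_delta by metis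
  obtain e2 where e2: "e2 > 0" "ball (F x0) e2 \<subseteq> V"
    using V open_contains_ball by blast
  \<comment> \<open>The ball is chosen on the image side because convexity is needed for the mean
    value estimate of \<open>g\<close>. The radius \<open>e1\<close> keeps \<open>g\<close> where
    \<open>lower\<close> holds, and \<open>e2\<close> keeps the ball inside
    \<open>V\<close>.\<close>
  define W where "W = ball (F x0) (min e1 e2)"
  have W: "W \<subseteq> V" "open W" "convex W" "F x0 \<in> W"
    and gW: "\<And>y. y \<in> W \<Longrightarrow> dist (g y) x0 < r"
    using e1 e2 by (auto simp: W_def dist_commute)
  have homW: "homeomorphism (g ` W) W F g"
  proof (rule homeomorphism_of_subsets[OF hom])
    have "F (g y) = y" if "y \<in> W" for y
      using hom W(1) that by (auto simp: homeomorphism_def)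
    then show "F ` g ` W = W" by (force simp: image_image)
    show "g ` W \<subseteq> U" using hom W(1) by (auto simp: homeomorphism_def)
  qed (rule W(1))
  have FgW: "F ` (g ` W) = W"
    using homW by (simp add: homeomorphism_def)
  have "openin (top_of_set U) (g ` W)"
  proof (rule homeomorphism_imp_open_map[of V U g F])
    show "homeomorphism V U g F" using hom by (rule homeomorphism_symD)
    show "openin (top_of_set V) W" using W(1,2) V(1) by (simp add: openin_open_eq)
  qed
  then have openU: "open (g ` W)"
    using U(1) openin_open_trans by blast
  define G where "G y = Blinfun (g' y)" for y
  have G: "blinfun_apply (G y) = g' y" if "y \<in> W" for y
    unfolding G_def using g[of y] that W(1) by (intro bounded_linear_Blinfun_apply has_derivative_bounded_linear) auto
  have FG: "F' (g y) (G y v) = v" and GF: "G y (F' (g y) v) = v" if "y \<in> W" for y v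
    using g'[of y] bij[of y] that W(1) G[OF that]
    by (auto simp: bij_is_surj surj_f_inv_f bij_is_inj)
  have normG: "norm (G y) \<le> 2 * B" if "y \<in> W" for y
  proof (rule norm_blinfun_bound)
    show "norm (G y v) \<le> 2 * B * norm v" for v
      using lower[OF gW[OF that], of "G y v"] by (simp add: FG[OF that])
  qed (use B in auto)
  have derG: "(g has_derivative blinfun_apply (G y)) (at y)" if "y \<in> W" for y
    using g[of y] W(1) that by (auto simp: G)
  have lip: "norm (g x - g y) \<le> 2 * B * norm (x - y)" if "x \<in> W" "y \<in> W" for x y
    using W(3) _ _ that
  proof (rule differentiable_bound)
    show "(g has_derivative blinfun_apply (G y)) (at y within W)" if "y \<in> W" for y
      using derG[OF that] by (rule has_derivative_at_withinI)
    show "onorm (blinfun_apply (G y)) \<le> 2 * B" if "y \<in> W" for y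
      using normG[OF that] by (simp add: norm_blinfun.rep_eq)
  qed
  \<comment> \<open>Testing the Hoelder estimate at two points of distance 1 fixes the sign of
    \<open>K\<close>.\<close>
  have K: "K \<ge> 0"
  proof -
    obtain b :: 'a where "b \<in> Basis" using nonempty_Basis by blast
    then have "norm (b - 0) = 1" by simp
    then show ?thesis using order_trans[OF norm_ge_zero holder[of b 0]] by simp
  qed
  have holderG: "norm (G x - G y) \<le> (4 * B\<^sup>2 * K * (2 * B) powr \<alpha>) * norm (x - y) powr \<alpha>"
    if xy: "x \<in> W" "y \<in> W" for x y
  proof (rule norm_blinfun_bound)
    fix v
    \<comment> \<open>The identity S - T = S (inverse T - inverse S) T reduces the estimate for the
      inverse derivatives to the one for \<open>F'\<close>.\<close>
    have "(G x - G y) v = G x ((F' (g y) - F' (g x)) (G y v))"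
      using xy by (simp add: blinfun.bilinear_simps FG GF)
    then have "norm ((G x - G y) v) \<le> norm (G x) * (norm (F' (g y) - F' (g x)) * (norm (G y) * norm v))"
      by (smt (verit) norm_blinfun mult_left_mono norm_ge_zero)
    also have "\<dots> \<le> (2 * B) * ((K * (2 * B * norm (x - y)) powr \<alpha>) * ((2 * B) * norm v))"
    proof (intro mult_mono normG xy order_refl mult_nonneg_nonneg norm_ge_zero)
      have "norm (F' (g y) - F' (g x)) \<le> K * norm (g y - g x) powr \<alpha>"
        by (rule holder)
      also have "\<dots> \<le> K * (2 * B * norm (x - y)) powr \<alpha>"
        using lip[OF xy] K \<alpha> by (intro mult_left_mono powr_mono2) (auto simp: norm_minus_commute)
      finally show "norm (F' (g y) - F' (g x)) \<le> K * (2 * B * norm (x - y)) powr \<alpha>" .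
    qed (use B K in auto)
    also have "\<dots> = (4 * B\<^sup>2 * K * (2 * B) powr \<alpha>) * norm (x - y) powr \<alpha> * norm v"
      using B by (simp add: powr_mult power2_eq_square)
    finally show "norm ((G x - G y) v) \<le> (4 * B\<^sup>2 * K * (2 * B) powr \<alpha>) * norm (x - y) powr \<alpha> * norm v" .
  qed (use K in auto)
  have "C1_holder_diffeo_on \<alpha> F (g ` W)"
    unfolding C1_holder_diffeo_on_def FgW
    using openU W(2) homW C1_holder_onI[OF \<alpha> der holder] C1_holder_onI[OF \<alpha> derG holderG]
    by blast
  moreover have "x0 \<in> g ` W"
    using W(4) gx0 by force
  ultimately show ?thesis by blast
qed

subsection \<open>Obstruction to linearization\<close>

text \<open>The mean value inequality on a ball where \<open>f' x\<close> stays within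
  \<open>e\<close> of \<open>f' x0\<close>. The two-point form is what allows two nearby orbits to
  be compared with each other rather than with the base point.\<close>

lemma strict_derivative_of_C1:
  fixes f :: "'a::real_normed_vector \<Rightarrow> 'b::real_normed_vector" and f' :: "'a \<Rightarrow> 'a \<Rightarrow>\<^sub>L 'b"
  assumes U: "open U" "x0 \<in> U"
    and der: "\<And>x. x \<in> U \<Longrightarrow> (f has_derivative blinfun_apply (f' x)) (at x)"
    and cont: "continuous_on U f'" and e: "e > 0"
  obtains \<delta> where "\<delta> > 0"
    "\<And>z w. z \<in> ball x0 \<delta> \<Longrightarrow> w \<in> ball x0 \<delta> \<Longrightarrow> norm (f z - f w - f' x0 (z - w)) \<le> e * norm (z - w)"
proof -
  have "isCont f' x0"
    using cont U by (simp add: continuous_on_eq_continuous_at)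
  then obtain \<delta>1 where \<delta>1: "\<delta>1 > 0" "\<And>x. dist x x0 < \<delta>1 \<Longrightarrow> norm (f' x - f' x0) < e"
    using e unfolding continuous_at_eps_delta dist_norm by metis
  obtain \<delta>2 where \<delta>2: "\<delta>2 > 0" "ball x0 \<delta>2 \<subseteq> U"
    using U open_contains_ball by blast
  define \<delta> where "\<delta> = min \<delta>1 \<delta>2"
  have sub: "ball x0 \<delta> \<subseteq> U"
    using subset_ball[of \<delta> \<delta>2 x0] \<delta>2(2) by (simp add: \<delta>_def)
  show ?thesis
  proof
    show "\<delta> > 0" using \<delta>1 \<delta>2 by (simp add: \<delta>_def)
    fix z w assume zw: "z \<in> ball x0 \<delta>" "w \<in> ball x0 \<delta>"
    have "norm (f z - f w - f' x0 (z - w)) \<le> norm (z - w) * e"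
    proof (rule differentiable_bound_linearization[where S="ball x0 \<delta>" and f'="\<lambda>x. blinfun_apply (f' x)"])
      show "w + t *\<^sub>R (z - w) \<in> ball x0 \<delta>" if "t \<in> {0..1}" for t
        using convexD_alt[OF convex_ball zw(2,1), of t] that by (simp add: algebra_simps)
      show "(f has_derivative blinfun_apply (f' x)) (at x within ball x0 \<delta>)" if "x \<in> ball x0 \<delta>" for x
        using der[OF subsetD[OF sub that]] by (rule has_derivative_at_withinI)
      show "onorm (blinfun_apply (f' x) - blinfun_apply (f' x0)) \<le> e" if "x \<in> ball x0 \<delta>" for x
      proof -
        have "onorm (blinfun_apply (f' x) - blinfun_apply (f' x0)) = norm (f' x - f' x0)"
          by (simp add: norm_blinfun.rep_eq minus_blinfun.rep_eq fun_diff_def)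
        then show ?thesis
          using \<delta>1(2)[of x] that by (simp add: \<delta>_def dist_commute)
      qed
      show "x0 \<in> ball x0 \<delta>" using \<open>\<delta> > 0\<close> by simp
    qed
    then show "norm (f z - f w - f' x0 (z - w)) \<le> e * norm (z - w)"
      by (simp add: mult.commute)
  qed
qed

lemma diag2_mult_nth [simp]:
  "(diag2 a b *v z) $ 1 = a * z $ 1" "(diag2 a b *v z) $ 2 = b * z $ 2"
  by (simp_all add: diag2_def matrix_vector_mult_def sum_2)

lemma vec2_eq_iff: "(z::real^2) = w \<longleftrightarrow> z$1 = w$1 \<and> z$2 = w$2"
  by (simp add: vec_eq_iff forall_2)

lemma norm_vec2_le: "norm (z::real^2) \<le> \<bar>z$1\<bar> + \<bar>z$2\<bar>"
  using norm_le_l1_cart[of z] by (simp add: sum_2)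

text \<open>
  An orbit pair shrinking to \<open>0\<close> along the strong direction reads off the difference of a
  linearization's first coordinate exactly, since the conjugacy can be iterated to arbitrarily
  small scales, where \<open>\<Phi>\<close> is as close as desired to its derivative.
\<close>

lemma linearization_difference_along_orbits:
  fixes \<Phi> F :: "real^2 \<Rightarrow> real^2" and A :: "(real^2) \<Rightarrow>\<^sub>L (real^2)"
  assumes l1: "l1 \<noteq> 0"
    and strict: "\<And>e. e > 0 \<Longrightarrow> \<exists>\<delta>>0. \<forall>z\<in>ball 0 \<delta>. \<forall>w\<in>ball 0 \<delta>.
        norm (\<Phi> z - \<Phi> w - A (z - w)) \<le> e * norm (z - w)"
    and conj: "\<And>x. x \<in> V \<Longrightarrow> \<Phi> (F x) = diag2 l1 l2 *v \<Phi> x"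
    and z: "\<And>n. n \<ge> m \<Longrightarrow> z n \<in> V" "\<And>n. n \<ge> m \<Longrightarrow> F (z n) = z (Suc n)" "z \<longlonglongrightarrow> 0"
    and w: "\<And>n. n \<ge> m \<Longrightarrow> w n \<in> V" "\<And>n. n \<ge> m \<Longrightarrow> F (w n) = w (Suc n)" "w \<longlonglongrightarrow> 0"
    and diff: "\<And>n. n \<ge> k \<Longrightarrow> z n - w n = vector [l1^n * c, 0]"
  shows "\<Phi> (z m) $ 1 - \<Phi> (w m) $ 1 = A (axis 1 1) $ 1 * l1^m * c"
proof -
  define Q where "Q = \<Phi> (z m) $ 1 - \<Phi> (w m) $ 1"
  define a where "a = A (axis 1 1) $ 1"
  \<comment> \<open>The linear part is diagonal, so the first coordinate of the conjugacy is an
    equation of its own, with multiplier \<open>l1\<close>.\<close>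
  have iter: "\<Phi> (x (m + i)) $ 1 = l1^i * \<Phi> (x m) $ 1"
    if "\<And>n. n \<ge> m \<Longrightarrow> x n \<in> V" "\<And>n. n \<ge> m \<Longrightarrow> F (x n) = x (Suc n)" for x i
  proof (induction i)
    case (Suc i)
    have "\<Phi> (x (m + Suc i)) = \<Phi> (F (x (m + i)))" using that(2)[of "m + i"] by simp
    also have "\<dots> = diag2 l1 l2 *v \<Phi> (x (m + i))" by (rule conj) (use that in auto)
    finally show ?case using Suc by simp
  qed simp
  \<comment> \<open>Advancing by \<open>i\<close> steps multiplies the error by \<open>l1^i\<close>,
    and the separation of the two points carries the same factor. Dividing by it brings the relative
    error \<open>e\<close> from small scales back to time \<open>m\<close> without loss.\<close>
  have bound: "\<bar>Q - a * l1^m * c\<bar> \<le> e * \<bar>l1^m * c\<bar>" if e: "e > 0" for e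
  proof -
    obtain \<delta> where \<delta>: "\<delta> > 0" "\<And>z w. z \<in> ball 0 \<delta> \<Longrightarrow> w \<in> ball 0 \<delta> \<Longrightarrow>
        norm (\<Phi> z - \<Phi> w - A (z - w)) \<le> e * norm (z - w)"
      using strict[OF e] by blast
    have "\<forall>\<^sub>F n in sequentially. z n \<in> ball 0 \<delta> \<and> w n \<in> ball 0 \<delta> \<and> n \<ge> m \<and> n \<ge> k"
      using tendstoD[OF z(3) \<delta>(1)] tendstoD[OF w(3) \<delta>(1)]
        eventually_ge_at_top[of m] eventually_ge_at_top[of k]
      by eventually_elim (simp add: dist_norm)
    then obtain n where n: "z n \<in> ball 0 \<delta>" "w n \<in> ball 0 \<delta>" "n \<ge> m" "n \<ge> k"
      using eventually_happens'[OF sequentially_bot] by blast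
    then obtain i where i: "n = m + i" using le_Suc_ex by blast
    have e1: "(vector [t, 0] :: real^2) = t *\<^sub>R axis 1 1" for t
      by (simp add: vec2_eq_iff axis_def)
    have "norm (\<Phi> (z n) - \<Phi> (w n) - A (z n - w n)) \<le> e * norm (z n - w n)"
      using \<delta>(2) n by blast
    moreover have "norm (z n - w n) = \<bar>l1^n * c\<bar>" "A (z n - w n) $ 1 = (l1^n * c) * a"
      unfolding diff[OF n(4)] e1 by (simp_all add: blinfun.bilinear_simps a_def)
    moreover have "\<bar>(\<Phi> (z n) - \<Phi> (w n) - A (z n - w n)) $ 1\<bar> \<le> norm (\<Phi> (z n) - \<Phi> (w n) - A (z n - w n))"
      by (rule component_le_norm_cart)
    ultimately have "\<bar>\<Phi> (z n) $ 1 - \<Phi> (w n) $ 1 - (l1^n * c) * a\<bar> \<le> e * \<bar>l1^n * c\<bar>"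
      by simp
    moreover have "\<Phi> (z n) $ 1 - \<Phi> (w n) $ 1 - (l1^n * c) * a = l1^i * (Q - a * l1^m * c)"
      using iter[where x=z and i=i, OF z(1,2)] iter[where x=w and i=i, OF w(1,2)]
      by (simp add: i Q_def algebra_simps power_add)
    ultimately have "\<bar>l1\<bar>^i * \<bar>Q - a * l1^m * c\<bar> \<le> \<bar>l1\<bar>^i * (e * \<bar>l1^m * c\<bar>)"
      by (simp add: i abs_mult power_add power_abs mult_ac)
    then show ?thesis using l1 by simp
  qed
  have "\<bar>Q - a * l1^m * c\<bar> \<le> 0"
  proof (rule field_le_epsilon)
    fix e :: real assume "e > 0"
    define M where "M = \<bar>l1^m * c\<bar>"
    have M: "M \<ge> 0" by (simp add: M_def)
    \<comment> \<open>Dividing by \<open>M + 1\<close> avoids the case \<open>M = 0\<close>.\<close>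
    have "\<bar>Q - a * l1^m * c\<bar> \<le> e / (M + 1) * M"
      unfolding M_def by (rule bound) (use \<open>e > 0\<close> in \<open>simp add: add_nonneg_pos\<close>)
    also have "\<dots> \<le> e"
      using \<open>e > 0\<close> M by (simp add: divide_le_eq field_simps)
    finally show "\<bar>Q - a * l1^m * c\<bar> \<le> 0 + e" by simp
  qed
  then show ?thesis by (simp add: Q_def a_def)
qed

text \<open>Differentiating the conjugacy at 0 shows that \<open>A\<close> commutes with the
  diagonal matrix, so \<open>A\<close> sends the first basis vector into the
  \<open>l1\<close>-eigenspace, that is, to a multiple of itself. As the derivative of a
  diffeomorphism \<open>A\<close> is injective, so the multiple is nonzero.\<close>

lemma linearization_derivative_nondegenerate:
  fixes \<Phi> F :: "real^2 \<Rightarrow> real^2" and A :: "(real^2) \<Rightarrow>\<^sub>L (real^2)"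
  assumes "l1 \<noteq> l2" and F: "F 0 = 0" "(F has_derivative (\<lambda>v. diag2 l1 l2 *v v)) (at 0)"
    and \<Phi>: "C1_diffeo_on \<Phi> U" "0 \<in> U" "(\<Phi> has_derivative blinfun_apply A) (at 0)"
    and V: "open V" "0 \<in> V" and conj: "\<And>x. x \<in> V \<Longrightarrow> \<Phi> (F x) = diag2 l1 l2 *v \<Phi> x"
  shows "A (axis 1 1) $ 1 \<noteq> 0"
proof
  let ?e = "axis 1 1 :: real^2"
  assume zero: "A ?e $ 1 = 0"
  have "(\<Phi> has_derivative blinfun_apply A) (at (F 0))"
    using \<Phi>(3) F(1) by simp
  then have 1: "((\<lambda>x. \<Phi> (F x)) has_derivative (\<lambda>v. A (diag2 l1 l2 *v v))) (at 0)"
    by (rule has_derivative_compose[OF F(2)])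
  have "((\<lambda>x. diag2 l1 l2 *v \<Phi> x) has_derivative (\<lambda>v. diag2 l1 l2 *v A v)) (at 0)"
    by (rule bounded_linear.has_derivative[OF matrix_vector_mul_bounded_linear \<Phi>(3)])
  then have 2: "((\<lambda>x. \<Phi> (F x)) has_derivative (\<lambda>v. diag2 l1 l2 *v A v)) (at 0)"
    by (rule has_derivative_transform_within_open[OF _ V]) (simp add: conj)
  have "A (diag2 l1 l2 *v ?e) = diag2 l1 l2 *v A ?e"
    using has_derivative_unique[OF 1 2] by (rule fun_cong)
  moreover have "diag2 l1 l2 *v ?e = l1 *\<^sub>R ?e"
    by (simp add: vec2_eq_iff axis_def)
  ultimately have "l1 *\<^sub>R A ?e = diag2 l1 l2 *v A ?e"
    by (simp add: blinfun.bilinear_simps)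
  then have "l1 * A ?e $ 2 = l2 * A ?e $ 2"
    by (simp add: vec2_eq_iff)
  then have "A ?e = 0"
    using zero assms(1) by (simp add: vec2_eq_iff)
  obtain g where g: "homeomorphism U (\<Phi> ` U) \<Phi> g" "C1_on g (\<Phi> ` U)"
    using \<Phi>(1) by (auto simp: C1_diffeo_on_def)
  then obtain G where "(g has_derivative blinfun_apply G) (at (\<Phi> 0))"
    using \<Phi>(2) unfolding C1_on_def by blast
  then have "((\<lambda>x. g (\<Phi> x)) has_derivative (\<lambda>v. G (A v))) (at 0)"
    by (rule has_derivative_compose[OF \<Phi>(3)])
  moreover have "((\<lambda>x. g (\<Phi> x)) has_derivative (\<lambda>v. v)) (at 0)"
  proof (rule has_derivative_transform_within_open[OF has_derivative_ident _ \<Phi>(2)])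
    show "open U" using \<Phi>(1) by (simp add: C1_diffeo_on_def)
    show "x = g (\<Phi> x)" if "x \<in> U" for x
      using g(1) that by (simp add: homeomorphism_def)
  qed
  ultimately have "(\<lambda>v. G (A v)) = (\<lambda>v. v)"
    by (rule has_derivative_unique)
  then have "G (A ?e) = ?e" by (rule fun_cong)
  then show False
    using \<open>A ?e = 0\<close> by (simp add: blinfun.bilinear_simps axis_eq_0_iff)
qed

text \<open>Separates the obstruction from the construction. Writing the first coordinate as
  \<open>l1^n * (1 + u)\<close> turns the dynamics into an additive law for the relative offset
  \<open>u\<close>, valid while \<bar>u\<bar> \<le> d.\<close>

lemma not_C1_linearizable_of_drift:
  fixes F :: "real^2 \<Rightarrow> real^2" and l1 l2 d :: real
  assumes l: "0 < \<bar>l1\<bar>" "\<bar>l1\<bar> < \<bar>l2\<bar>" "\<bar>l2\<bar> < 1" and d: "0 < d" "d \<le> 1"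
    and F0: "F 0 = 0" and derF: "(F has_derivative (\<lambda>v. diag2 l1 l2 *v v)) (at 0)"
    and axis1: "\<And>x. F (vector [x, 0]) = vector [l1 * x, 0]"
    and axis2: "\<And>y. F (vector [0, y]) = vector [0, l2 * y]"
    and drift: "\<And>n N u y. y = (l1 / l2)^N \<Longrightarrow> \<bar>u\<bar> \<le> d \<Longrightarrow>
      F (vector [l1^n * (1 + u), l2^n * y]) =
        vector [l1^Suc n * (1 + (if n < N then u + y / l1 else u)), l2^Suc n * y]"
  shows "\<not> C1_linearizable_near_0 (diag2 l1 l2) F"
proof
  assume "C1_linearizable_near_0 (diag2 l1 l2) F"
  then obtain \<Phi> U V where U: "0 \<in> U" "C1_diffeo_on \<Phi> U" and V: "open V" "0 \<in> V" "V \<subseteq> U"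
    and conj: "\<And>x. x \<in> V \<Longrightarrow> \<Phi> (F x) = diag2 l1 l2 *v \<Phi> x"
    unfolding C1_linearizable_near_0_def by blast
  obtain \<Phi>' :: "real^2 \<Rightarrow> (real^2) \<Rightarrow>\<^sub>L (real^2)" where
    \<Phi>': "\<And>x. x \<in> U \<Longrightarrow> (\<Phi> has_derivative blinfun_apply (\<Phi>' x)) (at x)" "continuous_on U \<Phi>'"
    using U(2) unfolding C1_diffeo_on_def C1_on_def by blast
  have openU: "open U" using U(2) by (simp add: C1_diffeo_on_def)
  define A where "A = \<Phi>' 0"
  have strict: "\<exists>\<delta>>0. \<forall>z\<in>ball 0 \<delta>. \<forall>w\<in>ball 0 \<delta>.
      norm (\<Phi> z - \<Phi> w - A (z - w)) \<le> e * norm (z - w)" if "e > 0" for e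
    unfolding A_def using strict_derivative_of_C1[OF openU U(1) \<Phi>' that] by metis
  define a where "a = A (axis 1 1) $ 1"
  have a: "a \<noteq> 0"
    unfolding a_def
    by (rule linearization_derivative_nondegenerate[OF _ F0 derF U(2,1) _ V(1,2) conj])
      (use l \<Phi>'(1)[OF U(1)] in \<open>auto simp: A_def\<close>)
  have l1: "l1 \<noteq> 0" and l2: "l2 \<noteq> 0" using l by auto
  note diff = linearization_difference_along_orbits[where V=V, OF l1 strict conj, folded a_def]
  define L where "L = 1 + norm A"
  obtain \<delta>0 where \<delta>0: "\<delta>0 > 0" "\<And>z w. z \<in> ball 0 \<delta>0 \<Longrightarrow> w \<in> ball 0 \<delta>0 \<Longrightarrow>
      norm (\<Phi> z - \<Phi> w - A (z - w)) \<le> 1 * norm (z - w)"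
    using strict[of 1] zero_less_one by blast
  have lip: "\<bar>\<Phi> z $ 1 - \<Phi> w $ 1\<bar> \<le> L * norm (z - w)" if "z \<in> ball 0 \<delta>0" "w \<in> ball 0 \<delta>0" for z w
  proof -
    have "\<bar>\<Phi> z $ 1 - \<Phi> w $ 1\<bar> \<le> norm (\<Phi> z - \<Phi> w)"
      using component_le_norm_cart[of "\<Phi> z - \<Phi> w" 1] by simp
    also have "\<dots> \<le> norm (\<Phi> z - \<Phi> w - A (z - w)) + norm (A (z - w))"
      by (rule norm_triangle_sub[of _ "A (z - w)", THEN order_trans]) simp
    also have "\<dots> \<le> 1 * norm (z - w) + norm A * norm (z - w)"
      by (intro add_mono \<delta>0(2) that norm_blinfun)
    finally show ?thesis by (simp add: L_def algebra_simps)
  qed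
  obtain \<delta>1 where \<delta>1: "\<delta>1 > 0" "ball 0 \<delta>1 \<subseteq> V"
    using V open_contains_ball by blast
  define \<delta> where "\<delta> = min \<delta>0 \<delta>1"
  have \<delta>: "\<delta> > 0" using \<delta>0 \<delta>1 by (simp add: \<delta>_def)
  have l2lim: "(\<lambda>n. 3 * \<bar>l2\<bar>^n) \<longlonglongrightarrow> 0"
    using l by (intro tendsto_mult_right_zero LIMSEQ_power_zero) auto
  then have "\<forall>\<^sub>F n in sequentially. 3 * \<bar>l2\<bar>^n < \<delta>"
    using \<delta> by (rule order_tendstoD(2))
  \<comment> \<open>The starting time \<open>m\<close> is fixed before \<open>N\<close>: all points
    \<open>(l1^n s, l2^n t)\<close> with \<bar>s\<bar> \<le> 2, \<bar>t\<bar> \<le> 1 and n \<ge> m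
    lie in the good neighbourhoods, whatever \<open>N\<close> will be.\<close>
  then obtain m where m: "\<And>n. n \<ge> m \<Longrightarrow> 3 * \<bar>l2\<bar>^n < \<delta>"
    unfolding eventually_sequentially by blast
  have small: "vector [l1^n * s, l2^n * t] \<in> ball 0 \<delta>0 \<inter> V"
    if "n \<ge> m" "norm (vector [l1^n * s, l2^n * t] :: real^2) \<le> 3 * \<bar>l2\<bar>^n" for n s t
    using m[OF that(1)] that(2) \<delta>1(2) by (auto simp: \<delta>_def)
  have norm_le: "norm (vector [l1^n * s, l2^n * t] :: real^2) \<le> 3 * \<bar>l2\<bar>^n"
    if "\<bar>s\<bar> \<le> 2" "\<bar>t\<bar> \<le> 1" for n s t
  proof -
    have "norm (vector [l1^n * s, l2^n * t] :: real^2) \<le> \<bar>l1\<bar>^n * \<bar>s\<bar> + \<bar>l2\<bar>^n * \<bar>t\<bar>"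
      using norm_vec2_le[of "vector [l1^n * s, l2^n * t]"] by (simp add: abs_mult power_abs)
    also have "\<dots> \<le> \<bar>l2\<bar>^n * 2 + \<bar>l2\<bar>^n * 1"
      using l that by (intro add_mono mult_mono power_mono) simp_all
    finally show ?thesis by simp
  qed
  have to_0: "(\<lambda>n. vector [l1^n * s n, l2^n * t] :: real^2) \<longlonglongrightarrow> 0"
    if "\<And>n. \<bar>s n\<bar> \<le> 2" "\<bar>t\<bar> \<le> 1" for s t
    by (rule Lim_null_comparison[OF _ l2lim]) (use norm_le that in auto)
  have zero_vec: "(vector [0, 0] :: real^2) = 0" by (simp add: vec2_eq_iff)
  have V0: "\<Phi> (vector [l1^m, 0]) $ 1 - \<Phi> 0 $ 1 = a * l1^m"
  proof -
    have "\<Phi> (vector [l1^m * 1, l2^m * 0]) $ 1 - \<Phi> (vector [l1^m * 0, l2^m * 0]) $ 1 = a * l1^m * 1"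
    proof (rule diff[where k=0 and z="\<lambda>n. vector [l1^n * 1, l2^n * 0]"
        and w="\<lambda>n. vector [l1^n * 0, l2^n * 0]"])
      show "(\<lambda>n. vector [l1^n * 1, l2^n * 0] :: real^2) \<longlonglongrightarrow> 0"
        "(\<lambda>n. vector [l1^n * 0, l2^n * 0] :: real^2) \<longlonglongrightarrow> 0"
        by (rule to_0; simp)+
      show "vector [l1^n * 1, l2^n * 0] \<in> V" "vector [l1^n * 0, l2^n * 0] \<in> V" if "n \<ge> m" for n
        using small[OF that norm_le, of 1 0] small[OF that norm_le, of 0 0] by simp_all
    qed (simp_all add: axis1 vec2_eq_iff)
    then show ?thesis by (simp add: zero_vec)
  qed
  define \<sigma> where "\<sigma> = l1 / l2"
  have \<sigma>: "0 < \<bar>\<sigma>\<bar>" "\<bar>\<sigma>\<bar> < 1" using l by (auto simp: \<sigma>_def)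
  \<comment> \<open>The hypothesis says that the total drift stays within \<open>d\<close>. The
    bound obtained for \<open>N - m\<close> does not depend on \<open>N\<close>, since the factor
    \<bar>y\<bar> cancels from both sides.\<close>
  have key: "\<bar>a\<bar> * \<bar>l1\<bar>^m * real (N - m) / \<bar>l1\<bar> \<le> 2 * L * \<bar>l2\<bar>^m"
    if N: "real (N - m) * \<bar>\<sigma>^N / l1\<bar> \<le> d" "N \<ge> m" for N
  proof -
    define y where "y = \<sigma>^N"
    have y: "\<bar>y\<bar> \<le> 1" "y \<noteq> 0"
      using \<sigma> by (auto simp: y_def power_abs power_le_one)
    \<comment> \<open>The offset accumulated between times \<open>m\<close> and \<open>n\<close>;
      the minimum freezes it from time \<open>N\<close> on.\<close>
    define u where "u n = real (min n N - m) * y / l1" for n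
    have u: "\<bar>u n\<bar> \<le> d" for n
    proof -
      have "\<bar>u n\<bar> = real (min n N - m) * \<bar>\<sigma>^N / l1\<bar>"
        by (simp add: u_def y_def abs_mult)
      also have "\<dots> \<le> real (N - m) * \<bar>\<sigma>^N / l1\<bar>"
        by (intro mult_right_mono) auto
      finally show ?thesis using N(1) by linarith
    qed
    have um: "u m = 0" by (simp add: u_def)
    have u_Suc: "u (Suc n) = (if n < N then u n + y / l1 else u n)" if "n \<ge> m" for n
    proof (cases "n < N")
      case True
      then have "real (min (Suc n) N - m) = real (min n N - m) + 1"
        using that by (simp add: Suc_diff_le)
      then show ?thesis using True by (simp add: u_def add_divide_distrib distrib_right)
    qed (simp add: u_def)
    have abs_u: "\<bar>1 + u n\<bar> \<le> 2" for n using u[of n] d by linarith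
    have QN: "\<Phi> (vector [l1^m * (1 + u m), l2^m * y]) $ 1 - \<Phi> (vector [l1^m * 0, l2^m * y]) $ 1
        = a * l1^m * (1 + real (N - m) * y / l1)"
    \<comment> \<open>From time \<open>N\<close> on the offset has its final value, so the
      separation is exactly \<open>l1^n\<close> times a constant; hence \<open>k = N\<close>,
      although both orbits are followed from time \<open>m\<close>.\<close>
    proof (rule diff[where k=N and z="\<lambda>n. vector [l1^n * (1 + u n), l2^n * y]"
        and w="\<lambda>n. vector [l1^n * 0, l2^n * y]"])
      show "(\<lambda>n. vector [l1^n * (1 + u n), l2^n * y] :: real^2) \<longlonglongrightarrow> 0"
        by (rule to_0) (use abs_u y in auto)
      show "(\<lambda>n. vector [l1^n * 0, l2^n * y] :: real^2) \<longlonglongrightarrow> 0"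
        by (rule to_0) (use y in auto)
      fix n
      show "vector [l1^n * (1 + u n), l2^n * y] - vector [l1^n * 0, l2^n * y]
          = (vector [l1^n * (1 + real (N - m) * y / l1), 0] :: real^2)" if "n \<ge> N"
        using that by (simp add: vec2_eq_iff u_def min_def)
      assume n: "n \<ge> m"
      show "vector [l1^n * (1 + u n), l2^n * y] \<in> V"
        using small[OF n norm_le[OF abs_u y(1)]] by blast
      show "vector [l1^n * 0, l2^n * y] \<in> V"
        using small[OF n norm_le[OF _ y(1)], of 0] by simp
      show "F (vector [l1^n * (1 + u n), l2^n * y]) = vector [l1^Suc n * (1 + u (Suc n)), l2^Suc n * y]"
        unfolding u_Suc[OF n] by (rule drift) (use u in \<open>auto simp: y_def \<sigma>_def\<close>)
      show "F (vector [l1^n * 0, l2^n * y]) = vector [l1^Suc n * 0, l2^Suc n * y]"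
        using axis2[of "l2^n * y"] by (simp add: mult.assoc)
    qed
    have in_ball: "(vector [l1^m * s, l2^m * t] :: real^2) \<in> ball 0 \<delta>0" if "\<bar>s\<bar> \<le> 2" "\<bar>t\<bar> \<le> 1" for s t
      using small[OF order_refl norm_le[OF that]] by blast
    have vert: "\<bar>\<Phi> (vector [l1^m * s, l2^m * y]) $ 1 - \<Phi> (vector [l1^m * s, l2^m * 0]) $ 1\<bar>
        \<le> L * (\<bar>l2\<bar>^m * \<bar>y\<bar>)" if "\<bar>s\<bar> \<le> 2" for s
    proof -
      have "norm (vector [l1^m * s, l2^m * y] - vector [l1^m * s, l2^m * 0] :: real^2) \<le> \<bar>l2\<bar>^m * \<bar>y\<bar>"
        using norm_vec2_le[of "vector [l1^m * s, l2^m * y] - vector [l1^m * s, l2^m * 0]"]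
        by (simp add: abs_mult power_abs)
      then have "L * norm (vector [l1^m * s, l2^m * y] - vector [l1^m * s, l2^m * 0] :: real^2)
          \<le> L * (\<bar>l2\<bar>^m * \<bar>y\<bar>)"
        by (intro mult_left_mono) (auto simp: L_def add_nonneg_nonneg)
      then show ?thesis
        using lip[OF in_ball[OF that y(1)] in_ball[OF that, of 0]] by simp
    qed
    have abs_diff: "\<bar>t\<bar> \<le> 2 * M" if "t = p - q" "\<bar>p\<bar> \<le> M" "\<bar>q\<bar> \<le> M" for t p q M :: real
      using that by linarith
    have two: "\<bar>1::real\<bar> \<le> 2" "\<bar>0::real\<bar> \<le> 2" by simp_all
    \<comment> \<open>Subtracting \<open>V0\<close> from \<open>QN\<close> removes the common part
      \<open>a * l1^m\<close> and leaves the drift as a mixed second difference over a rectangle,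
      whose two vertical sides have length \<open>\<bar>l2\<bar>^m * \<bar>y\<bar>\<close>.\<close>
    have "a * l1^m * (real (N - m) * y / l1) =
        (\<Phi> (vector [l1^m * 1, l2^m * y]) $ 1 - \<Phi> (vector [l1^m * 1, l2^m * 0]) $ 1)
        - (\<Phi> (vector [l1^m * 0, l2^m * y]) $ 1 - \<Phi> (vector [l1^m * 0, l2^m * 0]) $ 1)"
      using QN V0 by (simp add: um zero_vec algebra_simps)
    then have "\<bar>a * l1^m * (real (N - m) * y / l1)\<bar> \<le> 2 * (L * (\<bar>l2\<bar>^m * \<bar>y\<bar>))"
      using vert[OF two(1)] vert[OF two(2)] by (rule abs_diff)
    then have "\<bar>y\<bar> * (\<bar>a\<bar> * \<bar>l1\<bar>^m * real (N - m) / \<bar>l1\<bar>) \<le> \<bar>y\<bar> * (2 * L * \<bar>l2\<bar>^m)"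
      by (simp add: abs_mult power_abs mult_ac)
    then show ?thesis by (rule mult_left_le_imp_le) (use y(2) in simp)
  qed
  define B where "B = \<bar>a\<bar> * \<bar>l1\<bar>^m / \<bar>l1\<bar>"
  have B: "B > 0" using a l1 by (simp add: B_def)
  \<comment> \<open>The two demands on \<open>N\<close> are compatible: the total drift is of order
    N \<sigma>^N and tends to 0, while \<open>N - m\<close> can exceed the bound from
    \<open>key\<close>.\<close>
  have "(\<lambda>N. real N * \<sigma>^N) \<longlonglongrightarrow> 0"
    using \<sigma> by (intro powser_times_n_limit_0) auto
  then have "\<forall>\<^sub>F N in sequentially. dist (real N * \<sigma>^N) 0 < d * \<bar>l1\<bar>"
    by (rule tendstoD) (use d l1 in simp)
  moreover have "\<forall>\<^sub>F N in sequentially. N \<ge> m + Suc (nat \<lceil>2 * L * \<bar>l2\<bar>^m / B\<rceil>)"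
    by (rule eventually_ge_at_top)
  ultimately have "\<forall>\<^sub>F N in sequentially. \<bar>real N * \<sigma>^N\<bar> < d * \<bar>l1\<bar> \<and>
      N \<ge> m + Suc (nat \<lceil>2 * L * \<bar>l2\<bar>^m / B\<rceil>)"
    by eventually_elim simp
  then obtain N where N: "\<bar>real N * \<sigma>^N\<bar> < d * \<bar>l1\<bar>"
    "N \<ge> m + Suc (nat \<lceil>2 * L * \<bar>l2\<bar>^m / B\<rceil>)"
    using eventually_happens'[OF sequentially_bot] by blast
  have "real (N - m) * \<bar>\<sigma>^N / l1\<bar> \<le> real N * \<bar>\<sigma>^N / l1\<bar>"
    by (intro mult_right_mono) auto
  also have "\<dots> \<le> d"
    using N(1) l1 by (simp add: abs_mult divide_le_eq)
  finally have "B * real (N - m) \<le> 2 * L * \<bar>l2\<bar>^m"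
    using key[of N] N(2) by (simp add: B_def)
  then have "real (N - m) \<le> 2 * L * \<bar>l2\<bar>^m / B"
    using B by (simp add: le_divide_eq mult.commute)
  then show False using N(2) by linarith
qed

subsection \<open>The counterexample\<close>

text \<open>With e = (1 - \<bar>l\<bar>) / 4, the outer edge (1 + e) \<bar>l\<bar> = 1 - 3e - 4e^2
  of the next smaller scale lies below the inner edge 1 - e of the current one. Comparing absolute
  values covers negative \<open>l\<close> too.\<close>

lemma power_scale_unique:
  fixes l x :: real
  assumes l: "0 < \<bar>l\<bar>" "\<bar>l\<bar> < 1" and j: "\<bar>x / l^j - 1\<bar> < (1 - \<bar>l\<bar>) / 4"
    and k: "\<bar>x / l^k - 1\<bar> < (1 - \<bar>l\<bar>) / 4"
  shows "j = k"
proof -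
  define e where "e = (1 - \<bar>l\<bar>) / 4"
  have e: "0 < e" "\<bar>l\<bar> = 1 - 4 * e" using l by (auto simp: e_def field_simps)
  have False if "i < n" and i: "\<bar>x / l^i - 1\<bar> < e" and n: "\<bar>x / l^n - 1\<bar> < e" for i n
  proof -
    have "1 - e < \<bar>x / l^i\<bar>" "\<bar>x / l^n\<bar> < 1 + e" using i n by linarith+
    then have 1: "(1 - e) * \<bar>l\<bar>^i < \<bar>x\<bar>" "\<bar>x\<bar> < (1 + e) * \<bar>l\<bar>^n"
      using l by (simp_all add: power_abs field_simps)
    have "\<bar>l\<bar>^n \<le> \<bar>l\<bar>^Suc i"
      using l that(1) by (intro power_decreasing) auto
    then have "(1 + e) * \<bar>l\<bar>^n \<le> (1 + e) * \<bar>l\<bar> * \<bar>l\<bar>^i"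
      using e(1) by (simp add: mult.assoc)
    with 1 have "(1 - e) * \<bar>l\<bar>^i < ((1 + e) * \<bar>l\<bar>) * \<bar>l\<bar>^i" by linarith
    then have "1 - e < (1 + e) * \<bar>l\<bar>" by (simp add: mult_less_cancel_right)
    also have "\<dots> = 1 - 3 * e - 4 * e^2" by (simp add: e(2) power2_eq_square algebra_simps)
    finally show False using e(1) zero_le_power2[of e] by linarith
  qed
  then show ?thesis
    using j k unfolding e_def by (metis linorder_neqE_nat)
qed

text \<open>By definition of \<open>alpha0\<close>, the ratio is exactly
  \<open>\<bar>l1\<bar> powr alpha0 l1 l2\<close>; lowering the exponent enlarges the power because
  \<open>ln \<bar>l1\<bar>\<close> is negative.\<close>

lemma ratio_le_powr_alpha0:
  fixes l1 l2 :: real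
  assumes "0 < \<bar>l1\<bar>" "\<bar>l1\<bar> < \<bar>l2\<bar>" "\<bar>l2\<bar> < 1" "\<alpha> \<le> alpha0 l1 l2"
  shows "\<bar>l1 / l2\<bar> \<le> \<bar>l1\<bar> powr \<alpha>" "\<alpha> < 1"
proof -
  have ln: "ln \<bar>l1\<bar> < 0" "ln \<bar>l2\<bar> < 0" using assms by auto
  have "\<bar>l1 / l2\<bar> = exp (ln \<bar>l1\<bar> - ln \<bar>l2\<bar>)"
    using assms by (simp add: exp_diff)
  also have "ln \<bar>l1\<bar> - ln \<bar>l2\<bar> = alpha0 l1 l2 * ln \<bar>l1\<bar>"
    using ln by (simp add: alpha0_def left_diff_distrib)
  also have "exp (alpha0 l1 l2 * ln \<bar>l1\<bar>) \<le> exp (\<alpha> * ln \<bar>l1\<bar>)"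
    using ln assms(4) by (simp add: mult_right_mono_neg)
  also have "\<dots> = \<bar>l1\<bar> powr \<alpha>"
    using assms by (simp add: powr_def)
  finally show "\<bar>l1 / l2\<bar> \<le> \<bar>l1\<bar> powr \<alpha>" .
  have "ln \<bar>l2\<bar> / ln \<bar>l1\<bar> > 0" using ln by (simp add: divide_neg_neg)
  then show "\<alpha> < 1" using assms(4) by (simp add: alpha0_def)
qed

theorem theorem1:
  fixes l1 l2 :: real
  assumes "0 < \<bar>l1\<bar>" and "\<bar>l1\<bar> < \<bar>l2\<bar>" and "\<bar>l2\<bar> < 1"
  shows "\<forall>\<alpha>\<in>{0<..alpha0 l1 l2}. \<exists>F :: real^2 \<Rightarrow> real^2.
           (\<exists>U. 0 \<in> U \<and> C1_holder_diffeo_on \<alpha> F U) \<and>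
           F 0 = 0 \<and>
           (F has_derivative (\<lambda>v. diag2 l1 l2 *v v)) (at 0) \<and>
           \<not> C1_linearizable_near_0 (diag2 l1 l2) F"
proof
  fix \<alpha> assume "\<alpha> \<in> {0<..alpha0 l1 l2}"
  then have \<alpha>: "0 < \<alpha>" "\<alpha> \<le> alpha0 l1 l2" by auto
  define \<sigma> where "\<sigma> = l1 / l2"
  \<comment> \<open>Chosen so that the support radius \<open>2 * d\<close> is the radius (1 -
    \<bar>l1\<bar>) / 4 of \<open>power_scale_unique\<close>.\<close>
  define d where "d = (1 - \<bar>l1\<bar>) / 8"
  have l1: "l1 \<noteq> 0" and l2: "l2 \<noteq> 0" using assms by auto
  have \<sigma>: "\<bar>\<sigma>\<bar> < 1" "\<bar>\<sigma>\<bar> \<le> \<bar>l1\<bar> powr \<alpha>" "\<sigma> \<noteq> 0"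
    using assms ratio_le_powr_alpha0[OF assms \<alpha>(2)] by (auto simp: \<sigma>_def)
  have \<alpha>1: "\<alpha> \<le> 1" using ratio_le_powr_alpha0[OF assms \<alpha>(2)] by simp
  have d: "0 < d" "d \<le> 1" "2 * d \<le> 1" using assms by (auto simp: d_def)
  obtain P :: "real^2 \<Rightarrow> real^2" and D where
    derP: "\<And>z. (P has_derivative blinfun_apply (D z)) (at z)" and
    D: "bounded_lipschitz D" and
    P2: "\<And>z. P z $ 2 = 0" and
    P_plateau: "\<And>z. \<bar>z$1 - 1\<bar> \<le> d \<Longrightarrow> \<bar>z$2\<bar> \<le> \<bar>\<sigma>\<bar> \<Longrightarrow> P z $ 1 = z$2" and
    P_far: "\<And>z. \<bar>z$1 - 1\<bar> \<ge> 2 * d \<Longrightarrow> P z = 0" and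
    D_far: "\<And>z. \<bar>z$1 - 1\<bar> \<ge> 2 * d \<Longrightarrow> D z = 0" and
    P_high: "\<And>z. \<bar>z$2\<bar> \<ge> 1 \<Longrightarrow> P z = 0" and
    P_axis: "\<And>z. z$2 = 0 \<Longrightarrow> P z = 0"
    by (rule obtain_planar_profile[OF d(1) abs_ge_zero \<sigma>(1)]) blast
  have far: "\<bar>x / l1^k - 1\<bar> \<ge> 2 * d" if "\<bar>x / l1^n - 1\<bar> < 2 * d" "k \<noteq> n" for x k n
    using power_scale_unique[of l1 x n k] that assms unfolding d_def by force
  have disj: "j = k" if "D (inverse (l1^j) *\<^sub>R z) \<noteq> 0" "D (inverse (l1^k) *\<^sub>R z) \<noteq> 0" for z j k
  proof (rule ccontr)
    assume "j \<noteq> k"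
    have "\<bar>z$1 / l1^j - 1\<bar> < 2 * d"
      using D_far[of "inverse (l1^j) *\<^sub>R z"] that(1) by (force simp: divide_inverse mult.commute)
    from far[OF this] \<open>j \<noteq> k\<close> show False
      using D_far[of "inverse (l1^k) *\<^sub>R z"] that(2) by (force simp: divide_inverse mult.commute)
  qed
  have P0: "P 0 = 0" by (rule P_axis) simp
  obtain f f' K where
    sums [rule_format]: "\<forall>z. (\<lambda>k. (l1 * \<sigma>)^k *\<^sub>R P (inverse (l1^k) *\<^sub>R z)) sums f z" and
    derf [rule_format]: "\<forall>z. (f has_derivative blinfun_apply (f' z)) (at z)" and
    holder [rule_format]: "\<forall>z w. norm (f' z - f' w) \<le> K * norm (z - w) powr \<alpha>" and
    f'0: "f' 0 = (\<Sum>k. \<sigma>^k *\<^sub>R D 0)"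
    by (rule self_similar_sum_C1_holder[OF derP D P0 \<alpha>(1) \<alpha>1 l1 \<sigma>(1,2) disj])
  have f_zero: "f z = 0" if "\<And>k. P (inverse (l1^k) *\<^sub>R z) = 0" for z
    using sums_unique2[OF sums[of z], of 0] by (simp add: that)
  \<comment> \<open>On the vertical axis every rescaled point has first coordinate 0, at distance 1
    \<ge> 2 d from the centre of the profile.\<close>
  have f_axis: "f z = 0" if "z$1 = 0 \<or> z$2 = 0" for z
    using that d P_far P_axis by (intro f_zero) auto
  have f_scale: "f z = (l1 * \<sigma>)^n *\<^sub>R P (inverse (l1^n) *\<^sub>R z)"
    if "z$1 = l1^n * (1 + u)" "\<bar>u\<bar> \<le> d" for z n u
  proof -
    have near: "\<bar>z$1 / l1^n - 1\<bar> < 2 * d" using that l1 d by simp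
    have "(\<lambda>k. (l1 * \<sigma>)^k *\<^sub>R P (inverse (l1^k) *\<^sub>R z)) sums
        (\<Sum>k\<in>{n}. (l1 * \<sigma>)^k *\<^sub>R P (inverse (l1^k) *\<^sub>R z))"
    proof (rule sums_finite)
      fix k assume "k \<notin> {n}"
      then have "\<bar>z$1 / l1^k - 1\<bar> \<ge> 2 * d" using far[OF near] by simp
      then show "(l1 * \<sigma>)^k *\<^sub>R P (inverse (l1^k) *\<^sub>R z) = 0"
        using P_far[of "inverse (l1^k) *\<^sub>R z"] by (simp add: divide_inverse mult.commute)
    qed simp
    then show ?thesis using sums_unique2[OF sums] by simp
  qed
  define F where "F z = diag2 l1 l2 *v z + f z" for z
  define \<Lambda> where "\<Lambda> = Blinfun (\<lambda>v::real^2. diag2 l1 l2 *v v)"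
  define F' where "F' z = \<Lambda> + f' z" for z
  have \<Lambda>: "blinfun_apply \<Lambda> = (\<lambda>v. diag2 l1 l2 *v v)"
    unfolding \<Lambda>_def by (rule bounded_linear_Blinfun_apply) (rule matrix_vector_mul_bounded_linear)
  have derF: "(F has_derivative blinfun_apply (F' z)) (at z)" for z
  proof -
    have "((\<lambda>z. blinfun_apply \<Lambda> z + f z) has_derivative (\<lambda>v. \<Lambda> v + f' z v)) (at z)"
      by (intro has_derivative_add bounded_linear_imp_has_derivative blinfun.bounded_linear_right derf)
    then show ?thesis
      by (simp add: F_def[abs_def] F'_def \<Lambda> plus_blinfun.rep_eq)
  qed
  have D0: "D 0 = 0" by (rule D_far) (use d in simp)
  have F'0: "F' 0 = \<Lambda>" by (simp add: F'_def f'0 D0)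
  have "\<exists>U. 0 \<in> U \<and> C1_holder_diffeo_on \<alpha> F U"
  proof (rule C1_holder_diffeo_near_invertible_derivative[OF \<alpha>(1) derF])
    show "norm (F' x - F' y) \<le> K * norm (x - y) powr \<alpha>" for x y
      using holder by (simp add: F'_def)
    define I where "I = Blinfun (\<lambda>v::real^2. diag2 (1 / l1) (1 / l2) *v v)"
    have I: "blinfun_apply I = (\<lambda>v. diag2 (1 / l1) (1 / l2) *v v)"
      unfolding I_def by (rule bounded_linear_Blinfun_apply) (rule matrix_vector_mul_bounded_linear)
    show "I o\<^sub>L F' 0 = id_blinfun"
      by (rule blinfun_eqI) (simp add: F'0 I \<Lambda> vec2_eq_iff l1 l2)
  qed
  moreover have F0: "F 0 = 0" by (simp add: F_def f_axis)
  moreover have derF0: "(F has_derivative (\<lambda>v. diag2 l1 l2 *v v)) (at 0)"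
    using derF[of 0] by (simp add: F'0 \<Lambda>)
  moreover have "\<not> C1_linearizable_near_0 (diag2 l1 l2) F"
  proof (rule not_C1_linearizable_of_drift[OF assms d(1,2) F0 derF0])
    show "F (vector [x, 0]) = vector [l1 * x, 0]" for x
      by (simp add: F_def f_axis vec2_eq_iff)
    show "F (vector [0, y]) = vector [0, l2 * y]" for y
      by (simp add: F_def f_axis vec2_eq_iff)
    fix n N u y assume y: "y = (l1 / l2)^N" and u: "\<bar>u\<bar> \<le> d"
    define z :: "real^2" where "z = vector [l1^n * (1 + u), l2^n * y]"
    define w where "w = inverse (l1^n) *\<^sub>R z"
    have fz: "f z = (l1 * \<sigma>)^n *\<^sub>R P w"
      unfolding w_def by (rule f_scale[of _ _ u]) (use u in \<open>simp_all add: z_def\<close>)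
    have y_eq: "y = \<sigma>^N" by (simp add: y \<sigma>_def)
    have w1: "w$1 = 1 + u" using l1 by (simp add: w_def z_def)
    \<comment> \<open>The rescaled second coordinate is \<sigma>^(N - n), written without negative
      exponents. For n < N it is at most \<bar>\<sigma>\<bar> in size, on the plateau of the
      profile; for n \<ge> N it is at least 1, where the profile vanishes.\<close>
    have w2: "\<sigma>^n * w$2 = \<sigma>^N"
      using l1 l2 by (simp add: w_def z_def y \<sigma>_def power_divide)
    have "f z = vector [if n < N then l1^n * y else 0, 0]"
    proof (cases "n < N")
      case True
      then obtain i where "N = n + Suc i" using less_imp_Suc_add by fastforce
      then have "w$2 = \<sigma>^Suc i" using w2 \<sigma>(3) by (simp add: power_add)
      then have "\<bar>w$2\<bar> \<le> \<bar>\<sigma>\<bar>"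
        using \<sigma>(1) by (simp add: abs_mult power_abs mult_left_le power_le_one)
      then have "P w $ 1 = w$2" using u w1 by (intro P_plateau) auto
      then have "f z $ 1 = l1^n * (\<sigma>^n * w$2)"
        by (simp add: fz power_mult_distrib)
      then have "f z $ 1 = l1^n * y" by (simp only: w2 y_eq)
      moreover have "f z $ 2 = 0" by (simp add: fz P2)
      ultimately show ?thesis using True by (simp add: vec2_eq_iff)
    next
      case False
      then obtain i where "n = N + i" using le_Suc_ex not_less by blast
      then have "\<sigma>^i * w$2 = 1" using w2 \<sigma>(3) by (simp add: power_add)
      then have "\<bar>\<sigma>\<bar>^i * \<bar>w$2\<bar> = 1" by (simp add: abs_mult[symmetric] power_abs[symmetric])
      moreover have "\<bar>\<sigma>\<bar>^i * \<bar>w$2\<bar> \<le> 1 * \<bar>w$2\<bar>"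
        using \<sigma>(1) by (intro mult_right_mono power_le_one) auto
      ultimately have "P w = 0" by (intro P_high) simp
      then show ?thesis using False by (simp add: fz vec2_eq_iff)
    qed
    \<comment> \<open>The increment \<open>l1^n * y\<close> equals
      \<open>l1^Suc n * (y / l1)\<close>, hence the relative drift \<open>y / l1\<close>.\<close>
    then show "F (vector [l1^n * (1 + u), l2^n * y]) =
        vector [l1^Suc n * (1 + (if n < N then u + y / l1 else u)), l2^Suc n * y]"
      using l1 unfolding z_def by (simp add: F_def vec2_eq_iff algebra_simps)
  qed
  ultimately show "\<exists>F :: real^2 \<Rightarrow> real^2.
           (\<exists>U. 0 \<in> U \<and> C1_holder_diffeo_on \<alpha> F U) \<and>
           F 0 = 0 \<and>
           (F has_derivative (\<lambda>v. diag2 l1 l2 *v v)) (at 0) \<and>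
           \<not> C1_linearizable_near_0 (diag2 l1 l2) F"
    by blast
qed

end
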